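(* Let $\xi(t)=\beta^{2}\sum_{p\geq2}\beta_{p}^{2}t^{p}$, not identically zero, satisfy $\xi(1+\epsilon)<\infty$ for some $\epsilon>0$, let $h\ge 0$, and set $\mathfrak{d}=\left(\frac{1}{\sqrt{\xi''}}\right)''$. Let $\{\mathfrak{d}>0\}=\bigcup_{i=1}^{N_{p}}(a_{i},b_{i})$ be the decomposition into connected components and similarly let $\{\mathfrak{d}\leq0\}=\bigcup_{i=1}^{N_{n}}[a_{i}',b_{i}']$ be the decomposition into connected components. Then the minimizer $\mu$ of $P_{\xi,h}$ over $\Pr([0,1])$ must be of the form $$\mu=\sum_{i=1}^{N_{p}}\left(m_{i,1}\delta_{q_{i,1}}+m_{i,2}\delta_{q_{i,2}}\right)+\sum_{i=1}^{N_{n}}\left(-\mathfrak{d}\,\mathbf{1}_{[r_{i,1},r_{i,2}]}\,ds+n_{i,1}\delta_{r_{i,1}}+n_{i,2}\delta_{r_{i,2}}\right)$$ for some points $q_{i,1},q_{i,2}\in[a_{i},b_{i}]$ and $r_{i,1},r_{i,2}\in[a_{i}',b_{i}']$ with $r_{i,1}\le r_{i,2}$, and some weights $m_{i,1},m_{i,2},n_{i,1},n_{i,2}\ge0$.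
   Context: Here $\beta$ and $\beta_p$ ($p\ge2$) are real numbers. $\Pr([0,1])$ is the set of Borel probability measures on $[0,1]$. For $\mu\in\Pr([0,1])$, let $\phi_{\mu}(t)=\int_{t}^{1}\mu([0,s])\,ds$ for $t\in[0,1]$; note $0\le\phi_\mu(s)\le 1-s$. The Crisanti-Sommers functional is $$P_{\xi,h}(\mu)=\frac{1}{2}\left(\int_{0}^{1}\xi''\phi_{\mu}\,ds+\int_{0}^{1}\left(\frac{1}{\phi_{\mu}}-\frac{1}{1-s}\right)ds+h^{2}\phi_{\mu}(0)\right)\in(-\infty,+\infty],$$ where the second integrand is non-negative (with $1/0=+\infty$). This functional is strictly convex, and its minimizer over $\Pr([0,1])$ is unique. The function $\mathfrak d$ is defined at the points of $[0,1]$ where $\xi''>0$, i.e. on $(0,1]$, and also at $0$ when $\xi''(0)>0$. It is either identically zero or has finitely many zeros in $[0,1]$, so that the sets $\{\mathfrak d>0\}$ and $\{\mathfrak d\le0\}$, regarded as subsets of $[0,1]$, have finitely many connected components ($N_p$ and $N_n$ in number, possibly $0$). The components of $\{\mathfrak d>0\}$ are written as open intervals $(a_i,b_i)$, up to possible inclusion of the endpoints $0$ or $1$ of $[0,1]$. The intervals $[a_i',b_i']$ may degenerate to single points. $\delta_x$ is the Dirac mass at $x$, $\mathbf 1_A$ is the indicator function of $A$, and $ds$ is Lebesgue measure. *)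

theory Defs
  imports "HOL-Probability.Probability"
begin

text \<open>Only the coefficients \<open>b p\<close> with \<open>p \<ge> 2\<close> occur; the summation index is \<open>p - 2\<close>.\<close>

definition mixture :: "real \<Rightarrow> (nat \<Rightarrow> real) \<Rightarrow> real \<Rightarrow> real" where
  "mixture \<beta> b t = \<beta>\<^sup>2 * (\<Sum>p. (b (p + 2))\<^sup>2 * t ^ (p + 2))"

definition deriv2 :: "(real \<Rightarrow> real) \<Rightarrow> real \<Rightarrow> real" where
  "deriv2 f = deriv (deriv f)"

definition Pr01 :: "real measure set" where
  "Pr01 = {\<mu>. prob_space \<mu> \<and> space \<mu> = {0..1} \<and> sets \<mu> = sets (restrict_space borel {0..1})}"

definition phi :: "real measure \<Rightarrow> real \<Rightarrow> real" where
  "phi \<mu> t = (LINT s:{t..1}|lborel. measure \<mu> {0..s})"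

text \<open>The second integrand is non-negative because \<open>0 \<le> phi \<mu> s \<le> 1 - s\<close>, so for \<open>s < 1\<close>
  the truncated subtraction of \<open>ennreal\<close> is the ordinary one, and \<open>1 / 0 = \<infinity>\<close> in \<open>ennreal\<close>.\<close>

definition crisanti_sommers :: "(real \<Rightarrow> real) \<Rightarrow> real \<Rightarrow> real measure \<Rightarrow> ereal" where
  "crisanti_sommers \<xi> h \<mu> =
     ereal (1 / 2) *
      (ereal (LINT s:{0..1}|lborel. deriv2 \<xi> s * phi \<mu> s)
       + enn2ereal (\<integral>\<^sup>+s\<in>{0..1}. (1 / ennreal (phi \<mu> s) - 1 / ennreal (1 - s)) \<partial>lborel)
       + ereal (h\<^sup>2 * phi \<mu> 0))"

text \<open>Meaningful only on \<open>dd_dom \<xi>\<close>. The series \<open>\<xi>\<close> converges in a neighbourhood of \<open>[0,1]\<close>, so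
  that two-sided derivatives may be used at the endpoints as well.\<close>

definition dd :: "(real \<Rightarrow> real) \<Rightarrow> real \<Rightarrow> real" where
  "dd \<xi> = deriv2 (\<lambda>t. 1 / sqrt (deriv2 \<xi> t))"

definition dd_dom :: "(real \<Rightarrow> real) \<Rightarrow> real set" where
  "dd_dom \<xi> = {t \<in> {0..1}. deriv2 \<xi> t > 0}"

definition dd_pos :: "(real \<Rightarrow> real) \<Rightarrow> real set" where
  "dd_pos \<xi> = {t \<in> dd_dom \<xi>. dd \<xi> t > 0}"

definition dd_nonpos :: "(real \<Rightarrow> real) \<Rightarrow> real set" where
  "dd_nonpos \<xi> = {t \<in> dd_dom \<xi>. dd \<xi> t \<le> 0}"

text \<open>The closed interval spanned by the endpoints of a component. The endpoint \<open>0\<close> belongs to it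
  even if the component omits \<open>0\<close> because \<open>deriv2 \<xi> 0 = 0\<close>.\<close>

definition hull_interval :: "real set \<Rightarrow> real set" where
  "hull_interval C = {Inf C..Sup C}"

end

theory Submission
  imports Defs "HOL-Complex_Analysis.Conformal_Mappings"
begin

text \<open>
  Write \<open>\<phi> = phi \<mu>\<close>, a concave function whose right derivative at \<open>t\<close> is \<open>- \<mu> [0, t]\<close>, and
  \<open>\<eta> = 1 / sqrt \<xi>''\<close>, so that \<open>dd \<xi> = \<eta>''\<close>. Moving a small part of the mass of the minimizer to a
  point \<open>x < 1\<close> cannot lower the energy. To first order this says (lemma \<open>euler_lagrange\<close>) that the
  potential \<open>K x = \<integral> (1 / \<phi>\<^sup>2 - \<xi>'') (s) * max 0 (x - s) ds - h\<^sup>2 * x\<close> is bounded below on \<open>[0,1)\<close> by a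
  constant \<open>k\<close> which it attains at \<open>\<mu>\<close>-almost every point. Thus \<open>\<mu>\<close> lives on the contact set \<open>{K = k}\<close>, on
  which \<open>K\<close> is minimal. The second derivative \<open>K'' = 1 / \<phi>\<^sup>2 - \<xi>''\<close> is nonnegative exactly where \<open>\<phi> \<le> \<eta>\<close>
  and zero exactly where \<open>\<phi> = \<eta>\<close>. In particular \<open>\<phi> \<le> \<eta>\<close> at every contact point in the domain of \<open>\<eta>\<close>,
  including \<open>0\<close>, because \<open>K' 0 = - h\<^sup>2 \<le> 0\<close>. If \<open>\<phi> \<le> \<eta>\<close> between two contact points, then \<open>K\<close> is
  convex there with minimal value at both ends, hence constant, so that \<open>\<phi> = \<eta>\<close> in between (lemma \<open>contact_between\<close>).

  Where \<open>dd \<xi> > 0\<close> the function \<open>\<eta>\<close> is strictly convex. If there were contact points \<open>x < y < z\<close>, then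
  \<open>\<phi> > \<eta>\<close> could not occur both between \<open>x\<close> and \<open>y\<close> and between \<open>y\<close> and \<open>z\<close>, because \<open>\<eta> - \<phi>\<close> is convex
  and \<open>\<phi> y \<le> \<eta> y\<close>. So \<open>\<phi> = \<eta>\<close> on one of these two intervals, where a concave function would agree with a
  strictly convex one. Hence at most two contact points, that is, at most two atoms, lie in a component.

  Where \<open>dd \<xi> \<le> 0\<close> the function \<open>\<eta>\<close> is concave. In a gap of the contact set \<open>\<mu>\<close> has no mass, so \<open>\<phi>\<close> is
  affine there; being below \<open>\<eta>\<close> at both ends it is below \<open>\<eta>\<close> throughout, and the whole gap consists of
  contact points. So the contact set meets the component in an interval, inside which \<open>\<phi> = \<eta>\<close> and
  \<open>\<mu>\<close> has density \<open>- \<phi>'' = - dd \<xi>\<close>; the two end points may carry additional atoms.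

  There are finitely many components because \<open>dd \<xi>\<close> has the sign of \<open>3/4 \<xi>'''\<^sup>2 - 1/2 \<xi>'' \<xi>''''\<close>, which is
  analytic near \<open>[0,1]\<close>. The point \<open>0\<close>, which is outside the domain of \<open>dd \<xi>\<close> when \<open>\<xi>'' 0 = 0\<close>,
  is in that case adjacent to a component where \<open>dd \<xi> > 0\<close>, since \<open>\<eta>\<close> tends to infinity
  at \<open>0\<close>; the argument for that component covers \<open>0\<close> as well.
\<close>

section \<open>Power series\<close>

lemma summable_iterated_diffs:
  fixes c :: "nat \<Rightarrow> 'a::{real_normed_field,banach}"
  assumes "\<And>z. norm z < R \<Longrightarrow> summable (\<lambda>n. c n * z ^ n)" "norm z < R"
  shows "summable (\<lambda>n. (diffs ^^ j) c n * z ^ n)"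
  using assms(2)
proof (induction j arbitrary: z)
  case 0
  then show ?case using assms(1) by simp
next
  case (Suc j)
  show ?case using termdiff_converges[OF Suc.prems Suc.IH] by simp
qed

lemma powser_iterated_deriv:
  fixes c :: "nat \<Rightarrow> 'a::{real_normed_field,banach}"
  assumes "\<And>z. norm z < R \<Longrightarrow> summable (\<lambda>n. c n * z ^ n)" "norm z < R"
  shows "((\<lambda>z. \<Sum>n. (diffs ^^ j) c n * z ^ n) has_field_derivative
           (\<Sum>n. (diffs ^^ Suc j) c n * z ^ n)) (at z)"
proof -
  have "\<And>z. norm z < R \<Longrightarrow> summable (\<lambda>n. (diffs ^^ j) c n * z ^ n)"
    by (rule summable_iterated_diffs[OF assms(1)])
  from termdiffs_strong'[OF this assms(2)] show ?thesis by simp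
qed

lemma iterated_diffs_nonneg:
  fixes a :: "nat \<Rightarrow> real"
  assumes "\<And>n. a n \<ge> 0"
  shows "(diffs ^^ j) a n \<ge> 0"
  by (induction j arbitrary: n) (auto simp: diffs_def assms)

lemma iterated_diffs_of_real:
  "(diffs ^^ j) (\<lambda>n. of_real (a n)) = (\<lambda>n. of_real ((diffs ^^ j) a n))"
  by (induction j) (auto simp: diffs_of_real[symmetric])

text \<open>
  The same coefficients define a holomorphic function on a disc of radius \<open>R > 1\<close>, and infinitely many
  zeros in the compact set \<open>[0,1]\<close> accumulate inside this disc, so that the identity theorem applies.
\<close>

lemma finite_zeros_powser_combination:
  fixes a :: "nat \<Rightarrow> real"
  assumes sm: "\<And>z::real. norm z < R \<Longrightarrow> summable (\<lambda>n. a n * z ^ n)" and R: "R > 1"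
  defines "G \<equiv> (\<lambda>j t. \<Sum>n. (diffs ^^ j) a n * t ^ n)"
  defines "D \<equiv> (\<lambda>t. 3/4 * (G 3 t)\<^sup>2 - 1/2 * G 2 t * G 4 t)"
  shows "finite {t\<in>{0..1}. D t = 0} \<or> (\<forall>t\<in>{0..1}. D t = 0)"
proof (rule disjCI)
  assume ne: "\<not> (\<forall>t\<in>{0..1}. D t = 0)"
  define c :: "nat \<Rightarrow> complex" where "c = (\<lambda>n. of_real (a n))"
  have smc: "summable (\<lambda>n. c n * z ^ n)" if z: "norm z < R" for z
  proof -
    obtain r where r: "norm z < r" "r < R" using dense[OF z] by blast
    have "summable (\<lambda>n. a n * r ^ n)" using r le_less_trans[OF norm_ge_zero r(1)] by (intro sm) auto
    then have "summable (\<lambda>n. complex_of_real (a n * r ^ n))" by (simp only: summable_complex_of_real)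
    then have "summable (\<lambda>n. c n * of_real r ^ n)" by (simp add: c_def)
    then show ?thesis
      by (rule powser_inside) (use r le_less_trans[OF norm_ge_zero r(1)] in simp)
  qed
  define H where "H = (\<lambda>j z. \<Sum>n. (diffs ^^ j) c n * z ^ n)"
  define E where "E = (\<lambda>z. 3/4 * (H 3 z)\<^sup>2 - 1/2 * H 2 z * H 4 z)"
  have H: "(H j) holomorphic_on (ball 0 R)" for j
    unfolding H_def using powser_iterated_deriv[of R c _ j, OF smc]
    by (subst holomorphic_on_open[OF open_ball]) (metis mem_ball_0)
  have E: "E holomorphic_on (ball 0 R)"
    unfolding E_def by (intro holomorphic_intros H)
  have HG: "H j (of_real t) = of_real (G j t)" if "\<bar>t\<bar> < R" for j t
  proof -
    have "summable (\<lambda>n. (diffs ^^ j) a n * t ^ n)"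
      by (rule summable_iterated_diffs[where R = R]) (use that sm in auto)
    from suminf_of_real[OF this, where 'a = complex] show ?thesis
      unfolding H_def G_def c_def iterated_diffs_of_real by simp
  qed
  have ED: "E (of_real t) = of_real (D t)" if "\<bar>t\<bar> < R" for t
    unfolding E_def D_def by (simp add: HG[OF that])
  show "finite {t\<in>{0..1}. D t = 0}" (is "finite ?Z")
  proof (rule ccontr)
    assume inf: "infinite ?Z"
    have "\<exists>x\<in>{0..1}. x islimpt ?Z"
      using inf compact_Icc[of 0 "1::real"] unfolding compact_eq_Bolzano_Weierstrass by blast
    then obtain x where x: "x \<in> {0..1}" "x islimpt ?Z" by blast
    have lim: "complex_of_real x islimpt (of_real ` ?Z)"
      unfolding islimpt_approachable
    proof (intro allI impI)
      fix e :: real assume "e > 0"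
      then obtain y where "y \<in> ?Z" "y \<noteq> x" "dist y x < e"
        using x(2) unfolding islimpt_approachable by blast
      then show "\<exists>x'\<in>complex_of_real ` ?Z. x' \<noteq> of_real x \<and> dist x' (of_real x) < e"
        by (intro bexI[of _ "of_real y"]) (auto simp: dist_of_real)
    qed
    have "E w = 0" if "w \<in> ball 0 R" for w
    proof (rule analytic_continuation[OF E open_ball connected_ball _ _ lim _ that])
      show "complex_of_real ` ?Z \<subseteq> ball 0 R" "complex_of_real x \<in> ball 0 R"
        using x R by (auto simp: norm_of_real)
      show "E z = 0" if "z \<in> complex_of_real ` ?Z" for z
        using that R ED by fastforce
    qed
    then have "D t = 0" if "t \<in> {0..1}" for t
      using ED[of t] that R by (simp add: norm_of_real)
    with ne show False by blast
  qed
qed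

lemma mixture_regularity:
  fixes \<beta> \<epsilon> :: real and b :: "nat \<Rightarrow> real"
  assumes xi: "\<xi> = mixture \<beta> b"
    and nonzero: "\<exists>t\<in>{0..1}. \<xi> t \<noteq> 0"
    and eps: "\<epsilon> > 0"
    and conv: "summable (\<lambda>p. (b (p + 2))\<^sup>2 * (1 + \<epsilon>) ^ (p + 2))"
  obtains R x3 x4 where "R > (1::real)"
    "\<And>t. \<bar>t\<bar> < R \<Longrightarrow> (deriv2 \<xi> has_real_derivative x3 t) (at t)"
    "\<And>t. \<bar>t\<bar> < R \<Longrightarrow> (x3 has_real_derivative x4 t) (at t)"
    "\<And>t. \<bar>t\<bar> < R \<Longrightarrow> isCont x4 t"
    "\<And>t. 0 < t \<Longrightarrow> t \<le> 1 \<Longrightarrow> deriv2 \<xi> t > 0"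
    "deriv2 \<xi> 0 \<ge> 0"
    "finite {t\<in>{0..1}. 3/4 * (x3 t)\<^sup>2 - 1/2 * deriv2 \<xi> t * x4 t = 0} \<or>
       (\<forall>t\<in>{0..1}. 3/4 * (x3 t)\<^sup>2 - 1/2 * deriv2 \<xi> t * x4 t = 0)"
proof -
  define R where "R = 1 + \<epsilon>"
  have R: "R > 1" using eps by (simp add: R_def)
  define a where "a = (\<lambda>n. if n < 2 then 0 else \<beta>\<^sup>2 * (b n)\<^sup>2)"
  have a0: "a n \<ge> 0" for n by (simp add: a_def)
  have "summable (\<lambda>n. a (n + 2) * R ^ (n + 2))"
    using summable_mult[OF conv, of "\<beta>\<^sup>2"] by (simp add: a_def R_def mult.assoc)
  then have "summable (\<lambda>n. a n * R ^ n)"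
    by (rule summable_iff_shift[THEN iffD1])
  then have sm: "summable (\<lambda>n. a n * z ^ n)" if "norm z < R" for z :: real
    using that R by (intro powser_inside[of a R z]) auto
  define G where "G = (\<lambda>j t. \<Sum>n. (diffs ^^ j) a n * t ^ n)"
  have G: "(G j has_real_derivative G (Suc j) t) (at t)" if "\<bar>t\<bar> < R" for j t
    using powser_iterated_deriv[of R a t j, OF sm] that unfolding G_def by simp
  have xi_eq: "\<xi> t = G 0 t" if "\<bar>t\<bar> < R" for t
  proof -
    have s: "summable (\<lambda>n. a n * t ^ n)" using sm that by simp
    have "summable (\<lambda>n. (b n)\<^sup>2 * R ^ n)"
      using conv summable_iff_shift[of "\<lambda>n. (b n)\<^sup>2 * R ^ n" 2] by (simp add: R_def)
    then have "summable (\<lambda>n. (b n)\<^sup>2 * t ^ n)"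
      by (rule powser_inside) (use that R in auto)
    then have s1: "summable (\<lambda>p. (b (p + 2))\<^sup>2 * t ^ (p + 2))"
      by (rule summable_ignore_initial_segment)
    have "G 0 t = (\<Sum>n. a (n + 2) * t ^ (n + 2)) + (\<Sum>n<2. a n * t ^ n)"
      using suminf_split_initial_segment[OF s, of 2] by (simp add: G_def)
    also have "\<dots> = (\<Sum>n. \<beta>\<^sup>2 * ((b (n + 2))\<^sup>2 * t ^ (n + 2)))"
      by (simp add: a_def mult.assoc)
    also have "\<dots> = mixture \<beta> b t"
      unfolding mixture_def by (rule suminf_mult[OF s1])
    finally show ?thesis by (simp add: xi)
  qed
  have op: "open {-R<..<R}" by simp
  have tr: "(f has_real_derivative d) (at t)"
    if "\<bar>t\<bar> < R" "(g has_real_derivative d) (at t)" "\<And>s. \<bar>s\<bar> < R \<Longrightarrow> g s = f s" for f g d t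
    by (rule has_field_derivative_transform_within_open[OF that(2) op])
       (use that in \<open>auto intro!: that(3)\<close>)
  have d0: "(\<xi> has_real_derivative G 1 t) (at t)" if t: "\<bar>t\<bar> < R" for t
    using G[OF t, of 0] by - (rule tr[OF t, of "G 0"], auto simp: xi_eq)
  have d1: "(deriv \<xi> has_real_derivative G 2 t) (at t)" if t: "\<bar>t\<bar> < R" for t
    using G[OF t, of 1] by - (rule tr[OF t, of "G 1"], auto simp: DERIV_imp_deriv[OF d0] numeral_2_eq_2)
  have e2: "deriv2 \<xi> t = G 2 t" if "\<bar>t\<bar> < R" for t
    unfolding deriv2_def by (rule DERIV_imp_deriv[OF d1[OF that]])
  have d2: "(deriv2 \<xi> has_real_derivative G 3 t) (at t)" if t: "\<bar>t\<bar> < R" for t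
    using G[OF t, of 2] by - (rule tr[OF t, of "G 2"], auto simp: e2 numeral_3_eq_3 numeral_2_eq_2)
  have d3: "(G 3 has_real_derivative G 4 t) (at t)" if "\<bar>t\<bar> < R" for t
    using G[OF that, of 3] by (simp add: eval_nat_numeral)
  have d4: "isCont (G 4) t" if "\<bar>t\<bar> < R" for t
    using G[OF that, of 4] DERIV_isCont by blast
  have pos: "G 2 t > 0" if "0 < t" "t \<le> 1" for t
  proof -
    obtain s where s: "s \<in> {0..1}" "\<xi> s \<noteq> 0" using nonzero by blast
    then have "G 0 s \<noteq> 0" using xi_eq[of s] R by auto
    then have "\<exists>n. a n \<noteq> 0"
      by (rule contrapos_np) (simp add: G_def)
    then obtain n where n: "a n \<noteq> 0" by blast
    then have n2: "n \<ge> 2" by (auto simp: a_def split: if_splits)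
    obtain m where m: "n = m + 2" using n2 le_Suc_ex by (metis add.commute)
    have p: "(diffs ^^ 2) a m > 0"
      using n a0[of n] m by (simp add: diffs_def numeral_2_eq_2)
    have "0 < (diffs ^^ 2) a m * t ^ m" using p that by simp
    also have "\<dots> = (\<Sum>i\<in>{m}. (diffs ^^ 2) a i * t ^ i)" by simp
    also have "\<dots> \<le> G 2 t"
    proof -
      have "summable (\<lambda>n. (diffs ^^ 2) a n * t ^ n)"
        using that R by (intro summable_iterated_diffs[where R = R]) (auto intro: sm)
      moreover have "0 \<le> (diffs ^^ 2) a i * t ^ i" for i
        using that iterated_diffs_nonneg[of a 2 i, OF a0] by simp
      ultimately show ?thesis
        unfolding G_def by (intro sum_le_suminf) auto
    qed
    finally show ?thesis .
  qed
  have z: "G 2 0 \<ge> 0"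
    unfolding G_def powser_zero by (rule iterated_diffs_nonneg[OF a0])
  have "finite {t\<in>{0..1}. 3/4 * (G 3 t)\<^sup>2 - 1/2 * G 2 t * G 4 t = 0} \<or>
       (\<forall>t\<in>{0..1}. 3/4 * (G 3 t)\<^sup>2 - 1/2 * G 2 t * G 4 t = 0)"
    using finite_zeros_powser_combination[OF sm R] unfolding G_def by simp
  moreover have "{t\<in>{0..1}. 3/4 * (G 3 t)\<^sup>2 - 1/2 * G 2 t * G 4 t = 0}
     = {t\<in>{0..1}. 3/4 * (G 3 t)\<^sup>2 - 1/2 * deriv2 \<xi> t * G 4 t = 0}"
    using R by (intro Collect_cong) (auto simp: e2)
  moreover have "(\<forall>t\<in>{0..1}. 3/4 * (G 3 t)\<^sup>2 - 1/2 * G 2 t * G 4 t = 0) \<longleftrightarrow>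
     (\<forall>t\<in>{0..1}. 3/4 * (G 3 t)\<^sup>2 - 1/2 * deriv2 \<xi> t * G 4 t = 0)"
    using R by (intro ball_cong) (auto simp: e2)
  ultimately have fin: "finite {t\<in>{0..1}. 3/4 * (G 3 t)\<^sup>2 - 1/2 * deriv2 \<xi> t * G 4 t = 0} \<or>
       (\<forall>t\<in>{0..1}. 3/4 * (G 3 t)\<^sup>2 - 1/2 * deriv2 \<xi> t * G 4 t = 0)" by simp
  have pos': "deriv2 \<xi> t > 0" if "0 < t" "t \<le> 1" for t
    using pos[OF that] e2[of t] R that by simp
  have z': "deriv2 \<xi> 0 \<ge> 0" using z e2[of 0] R by simp
  show thesis
    by (rule that[of R "G 3" "G 4"]) (fact R d2 d3 d4 pos' z' fin)+
qed

section \<open>The sign of the second derivative of the inverse square root\<close>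

lemma connected_real_borel:
  fixes C :: "real set" shows "connected C \<Longrightarrow> C \<in> sets borel"
  using real_interval_borel_measurable is_interval_connected_1 by blast

text \<open>
  The supremum of a component is a frontier point of \<open>X\<close>, as otherwise the component could be extended to
  the right. Disjoint intervals can have a common supremum only if one of them consists of this point
  alone, so a component is determined by its supremum together with the information whether it is a singleton.
\<close>

lemma finite_components_if_finite_frontier:
  fixes X :: "real set"
  assumes bdd: "bounded X" and fin: "finite (frontier X)"
  shows "finite (components X)"
proof -
  define g where "g = (\<lambda>C::real set. (Sup C, C = {Sup C}))"
  have C: "C \<noteq> {} \<and> connected C \<and> C \<subseteq> X \<and> bdd_above C" if "C \<in> components X" for C
    using in_components_nonempty[OF that] in_components_connected[OF that] in_components_subset[OF that]
      bounded_imp_bdd_above[OF bounded_subset[OF bdd in_components_subset[OF that]]] by simp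
  have "g ` components X \<subseteq> frontier X \<times> UNIV"
  proof (rule image_subsetI)
    fix C assume "C \<in> components X"
    then have CX: "C \<in> components X" "C \<noteq> {}" "connected C" "C \<subseteq> X" "bdd_above C"
      using C[of C] by simp_all
    define c where "c = Sup C"
    have c: "c = Sup C" by (simp add: c_def)
    have cl: "c \<in> closure C" unfolding c by (rule closure_contains_Sup[OF CX(2,5)])
    have "c \<notin> interior X"
    proof
      assume "c \<in> interior X"
      then obtain r where r: "r > 0" "ball c r \<subseteq> X" by (auto simp: mem_interior)
      have ne: "ball c r \<inter> C \<noteq> {}"
      proof
        assume "ball c r \<inter> C = {}"
        then have "ball c r \<inter> closure C = {}" by (simp add: open_Int_closure_eq_empty)
        then show False using cl r(1) by (metis IntI centre_in_ball empty_iff)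
      qed
      have "ball c r \<subseteq> C"
        by (rule components_maximal[OF CX(1) connected_ball r(2)]) (use ne in blast)
      then have "c + r/2 \<in> C" using r by (auto simp: dist_real_def)
      then have "c + r/2 \<le> c" unfolding c using CX(5) by (rule cSup_upper)
      then show False using r by simp
    qed
    moreover have "c \<in> closure X" using cl closure_mono[OF CX(4)] by blast
    ultimately show "g C \<in> frontier X \<times> UNIV" by (simp add: frontier_def g_def c_def)
  qed
  moreover have "inj_on g (components X)"
  proof (rule inj_onI, rule ccontr)
    fix A B assume A: "A \<in> components X" and B: "B \<in> components X" and g: "g A = g B" and ne: "A \<noteq> B"
    have disj: "A \<inter> B = {}" using components_eq[OF A B] ne by blast
    have s: "Sup A = Sup B" and e: "(A = {Sup A}) = (B = {Sup B})" using g by (auto simp: g_def)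
    have nA: "A \<noteq> {Sup A}" and nB: "B \<noteq> {Sup B}" using e s ne by auto
    have low: "\<exists>x\<in>D. x < Sup D" if D: "D \<in> components X" "D \<noteq> {Sup D}" for D
    proof (rule ccontr)
      assume "\<not> (\<exists>x\<in>D. x < Sup D)"
      then have "x = Sup D" if "x \<in> D" for x
        using C[OF D(1)] that cSup_upper[OF that] by fastforce
      then show False using C[OF D(1)] D(2) by blast
    qed
    have up: "z \<in> D" if D: "D \<in> components X" "x \<in> D" "x \<le> z" "z < Sup D" for D x z
    proof -
      obtain y where "y \<in> D" "z < y" using less_cSup_iff[of D z] C[OF D(1)] D by auto
      then show ?thesis using connectedD_interval[of D x y z] C[OF D(1)] D by auto
    qed
    obtain x where x: "x \<in> A" "x < Sup A" using low[OF A nA] by blast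
    obtain y where y: "y \<in> B" "y < Sup B" using low[OF B nB] by blast
    have "max x y \<in> A" using x y s by (intro up[OF A x(1)]) auto
    moreover have "max x y \<in> B" using x y s by (intro up[OF B y(1)]) auto
    ultimately show False using disj by blast
  qed
  moreover have "finite (frontier X \<times> (UNIV :: bool set))" using fin by simp
  ultimately show ?thesis
    using finite_imageD finite_subset by metis
qed

text \<open>
  The formula for \<open>dd\<close> separates a positive factor, singular at zeros of \<open>\<xi>''\<close>, from a numerator which is
  analytic near \<open>[0,1]\<close> and carries the sign.
\<close>

lemma inverse_sqrt_deriv2:
  assumes d2: "\<And>t. \<bar>t\<bar> < R \<Longrightarrow> (deriv2 \<xi> has_real_derivative x3 t) (at t)"
    and d3: "\<And>t. \<bar>t\<bar> < R \<Longrightarrow> (x3 has_real_derivative x4 t) (at t)"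
    and t: "\<bar>t\<bar> < R" "deriv2 \<xi> t > 0"
  defines "\<eta> \<equiv> (\<lambda>t. 1 / sqrt (deriv2 \<xi> t))"
  shows "(\<eta> has_real_derivative deriv \<eta> t) (at t)"
    and "(deriv \<eta> has_real_derivative dd \<xi> t) (at t)"
    and "dd \<xi> t = (3/4 * (x3 t)\<^sup>2 - 1/2 * deriv2 \<xi> t * x4 t) / ((deriv2 \<xi> t)\<^sup>2 * sqrt (deriv2 \<xi> t))"
proof -
  define U where "U = {-R<..<R} \<inter> deriv2 \<xi> -` {0<..}"
  have "continuous_on {-R<..<R} (deriv2 \<xi>)"
    by (intro continuous_at_imp_continuous_on ballI DERIV_isCont[OF d2]) auto
  then have U: "open U" unfolding U_def by (rule continuous_open_preimage) auto
  have e1: "(\<eta> has_real_derivative - x3 s / (2 * deriv2 \<xi> s * sqrt (deriv2 \<xi> s))) (at s)" if "s \<in> U" for s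
    unfolding \<eta>_def using that
    by (auto intro!: derivative_eq_intros d2 simp: U_def field_simps abs_less_iff)
  have tU: "t \<in> U" using t by (auto simp: U_def)
  then show "(\<eta> has_real_derivative deriv \<eta> t) (at t)"
    using DERIV_imp_deriv[OF e1] e1 by metis
  define v where "v = (3/4 * (x3 t)\<^sup>2 - 1/2 * deriv2 \<xi> t * x4 t) / ((deriv2 \<xi> t)\<^sup>2 * sqrt (deriv2 \<xi> t))"
  have "((\<lambda>s. - x3 s / (2 * deriv2 \<xi> s * sqrt (deriv2 \<xi> s))) has_real_derivative v) (at t)"
  proof -
    define s where "s = sqrt (deriv2 \<xi> t)"
    have s: "s > 0" "deriv2 \<xi> t = s^2" using t by (auto simp: s_def)
    have A: "((\<lambda>s. 2 * deriv2 \<xi> s) has_real_derivative 2 * x3 t) (at t)"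
      by (rule DERIV_cmult[OF d2[OF t(1)]])
    have B: "((\<lambda>s. sqrt (deriv2 \<xi> s)) has_real_derivative inverse (sqrt (deriv2 \<xi> t)) / 2 * x3 t) (at t)"
      by (rule DERIV_chain2[OF DERIV_real_sqrt[OF t(2)] d2[OF t(1)]])
    have nz: "2 * deriv2 \<xi> t * sqrt (deriv2 \<xi> t) \<noteq> 0" using t by simp
    note DERIV_divide[OF DERIV_minus[OF d3[OF t(1)]] DERIV_mult[OF A B] nz, folded s_def]
    moreover have "(- x4 t * (2 * deriv2 \<xi> t * s) - - x3 t * (2 * x3 t * s + inverse s / 2 * x3 t * (2 * deriv2 \<xi> t)))
        / (2 * deriv2 \<xi> t * s * (2 * deriv2 \<xi> t * s)) = v"
      unfolding v_def s_def[symmetric] s(2) using s(1)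
      by (simp add: field_simps power2_eq_square)
    ultimately show ?thesis by simp
  qed
  then have e2: "(deriv \<eta> has_real_derivative v) (at t)"
    by (rule has_field_derivative_transform_within_open[OF _ U tU]) (simp add: DERIV_imp_deriv[OF e1])
  moreover have e3: "dd \<xi> t = v"
    using DERIV_imp_deriv[OF e2] unfolding dd_def deriv2_def[of "\<lambda>t. 1 / sqrt (deriv2 \<xi> t)"] \<eta>_def .
  ultimately show "(deriv \<eta> has_real_derivative dd \<xi> t) (at t)" by simp
  show "dd \<xi> t = (3/4 * (x3 t)\<^sup>2 - 1/2 * deriv2 \<xi> t * x4 t) / ((deriv2 \<xi> t)\<^sup>2 * sqrt (deriv2 \<xi> t))"
    using e3 by (simp add: v_def)
qed

text \<open>
  The facts about \<open>\<xi>\<close> on which the analysis of the minimizer rests. The last one concerns the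
  point \<open>0\<close> when it is not in the domain of \<open>dd\<close>.
\<close>

lemma dd_structure:
  fixes \<beta> \<epsilon> :: real and b :: "nat \<Rightarrow> real"
  assumes xi: "\<xi> = mixture \<beta> b"
    and nonzero: "\<exists>t\<in>{0..1}. \<xi> t \<noteq> 0"
    and eps: "\<epsilon> > 0"
    and conv: "summable (\<lambda>p. (b (p + 2))\<^sup>2 * (1 + \<epsilon>) ^ (p + 2))"
  defines "\<eta> \<equiv> (\<lambda>t. 1 / sqrt (deriv2 \<xi> t))"
  shows "continuous_on {0..1} (deriv2 \<xi>)"
    and "\<And>t. 0 < t \<Longrightarrow> t \<le> 1 \<Longrightarrow> deriv2 \<xi> t > 0"
    and "deriv2 \<xi> 0 \<ge> 0"
    and "\<And>t. t \<in> dd_dom \<xi> \<Longrightarrow> (\<eta> has_real_derivative deriv \<eta> t) (at t)"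
    and "\<And>t. t \<in> dd_dom \<xi> \<Longrightarrow> (deriv \<eta> has_real_derivative dd \<xi> t) (at t)"
    and "continuous_on (dd_dom \<xi>) (dd \<xi>)"
    and "finite (components (dd_pos \<xi>))"
    and "finite (components (dd_nonpos \<xi>))"
    and "closed (dd_nonpos \<xi>)"
    and "deriv2 \<xi> 0 = 0 \<Longrightarrow> \<exists>\<delta>>0. \<delta> \<le> 1 \<and> {0<..<\<delta>} \<subseteq> dd_pos \<xi>"
proof -
  obtain R x3 x4 where R: "R > (1::real)"
    and d2: "\<And>t. \<bar>t\<bar> < R \<Longrightarrow> (deriv2 \<xi> has_real_derivative x3 t) (at t)"
    and d3: "\<And>t. \<bar>t\<bar> < R \<Longrightarrow> (x3 has_real_derivative x4 t) (at t)"
    and d4: "\<And>t. \<bar>t\<bar> < R \<Longrightarrow> isCont x4 t"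
    and pos: "\<And>t. 0 < t \<Longrightarrow> t \<le> 1 \<Longrightarrow> deriv2 \<xi> t > 0"
    and z: "deriv2 \<xi> 0 \<ge> 0"
    and fin: "finite {t\<in>{0..1}. 3/4 * (x3 t)\<^sup>2 - 1/2 * deriv2 \<xi> t * x4 t = 0} \<or>
       (\<forall>t\<in>{0..1}. 3/4 * (x3 t)\<^sup>2 - 1/2 * deriv2 \<xi> t * x4 t = 0)"
    using mixture_regularity[OF xi nonzero eps conv] by blast
  define D where "D = (\<lambda>t. 3/4 * (x3 t)\<^sup>2 - 1/2 * deriv2 \<xi> t * x4 t)"
  have fin: "finite {t\<in>{0..1}. D t = 0} \<or> (\<forall>t\<in>{0..1}. D t = 0)"
    using fin by (simp add: D_def)
  show "\<And>t. 0 < t \<Longrightarrow> t \<le> 1 \<Longrightarrow> deriv2 \<xi> t > 0" by fact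
  show "deriv2 \<xi> 0 \<ge> 0" by fact
  have domI: "t \<in> dd_dom \<xi>" if "0 < t" "t \<le> 1" for t using pos that by (simp add: dd_dom_def)
  have domR: "\<bar>t\<bar> < R \<and> deriv2 \<xi> t > 0" if "t \<in> dd_dom \<xi>" for t
    using that R by (auto simp: dd_dom_def)
  note e = inverse_sqrt_deriv2[of R \<xi> x3 x4, OF d2 d3, folded \<eta>_def]
  show h1: "(\<eta> has_real_derivative deriv \<eta> t) (at t)" if "t \<in> dd_dom \<xi>" for t
    using e(1) domR[OF that] by blast
  show h2: "(deriv \<eta> has_real_derivative dd \<xi> t) (at t)" if "t \<in> dd_dom \<xi>" for t
    using e(2) domR[OF that] by blast
  have h3: "dd \<xi> t = D t / ((deriv2 \<xi> t)\<^sup>2 * sqrt (deriv2 \<xi> t))" if "t \<in> dd_dom \<xi>" for t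
    using e(3) domR[OF that] by (simp add: D_def)
  have c2: "isCont (deriv2 \<xi>) t" if "\<bar>t\<bar> < R" for t using d2[OF that] by (rule DERIV_isCont)
  have c3: "isCont x3 t" if "\<bar>t\<bar> < R" for t using d3[OF that] by (rule DERIV_isCont)
  have cD: "isCont D t" if "\<bar>t\<bar> < R" for t
    unfolding D_def by (intro continuous_intros c2 c3 d4 that)
  show "continuous_on {0..1} (deriv2 \<xi>)"
    using R by (intro continuous_at_imp_continuous_on ballI c2) auto
  have "continuous_on (dd_dom \<xi>) (\<lambda>t. D t / ((deriv2 \<xi> t)\<^sup>2 * sqrt (deriv2 \<xi> t)))"
    by (intro continuous_intros continuous_at_imp_continuous_on ballI cD c2) (auto dest: domR)
  then show "continuous_on (dd_dom \<xi>) (dd \<xi>)"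
    by (rule continuous_on_eq) (simp add: h3)
  have sg1: "dd \<xi> t > 0 \<longleftrightarrow> D t > 0" if "t \<in> dd_dom \<xi>" for t
  proof -
    have "(deriv2 \<xi> t)\<^sup>2 * sqrt (deriv2 \<xi> t) > 0" using domR[OF that] by simp
    then show ?thesis by (simp add: h3[OF that] zero_less_divide_iff)
  qed
  have pos_eq: "dd_pos \<xi> = {t\<in>dd_dom \<xi>. D t > 0}" using sg1 by (auto simp: dd_pos_def)
  have np_eq: "dd_nonpos \<xi> = {t\<in>dd_dom \<xi>. D t \<le> 0}" using sg1 by (fastforce simp: dd_nonpos_def)
  define Z where "Z = (if finite {t\<in>{0..1}. D t = 0} then {t\<in>{0..1}. D t = 0} else {})"
  have finZ: "finite Z" by (simp add: Z_def)
  have loc: "\<exists>e>0. ball t e \<subseteq> {0<..<1} \<and> ((\<forall>s\<in>ball t e. D s > 0) \<or> (\<forall>s\<in>ball t e. D s \<le> 0))"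
    if "t \<notin> Z" and t01: "0 < t" "t < 1" for t
  proof -
    obtain e1 where e1: "e1 > 0" "ball t e1 \<subseteq> {0<..<1}"
      using openE[of "{0<..<1::real}" t] t01 by (metis greaterThanLessThan_iff open_greaterThanLessThan)
    show ?thesis
    proof (cases "finite {t\<in>{0..1}. D t = 0}")
      case True
      then have "D t \<noteq> 0" using that by (auto simp: Z_def)
      moreover have "isCont D t" using that R by (intro cD) auto
      ultimately obtain e2 where e2: "e2 > 0" "\<And>s. dist t s < e2 \<Longrightarrow> D s \<noteq> 0 \<and> (D s > 0 \<longleftrightarrow> D t > 0)"
      proof -
        from \<open>D t \<noteq> 0\<close> consider "D t > 0" | "D t < 0" by linarith
        then have "eventually (\<lambda>s. D s \<noteq> 0 \<and> (D s > 0 \<longleftrightarrow> D t > 0)) (at t)"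
        proof cases
          case 1
          then have "eventually (\<lambda>s. D s > 0) (at t)"
            using \<open>isCont D t\<close> unfolding isCont_def by (rule order_tendstoD(1)[rotated])
          then show ?thesis by (rule eventually_mono) (use 1 in auto)
        next
          case 2
          then have "eventually (\<lambda>s. D s < 0) (at t)"
            using \<open>isCont D t\<close> unfolding isCont_def by (rule order_tendstoD(2)[rotated])
          then show ?thesis by (rule eventually_mono) (use 2 in auto)
        qed
        then obtain e where "e > 0" "\<And>s. s \<noteq> t \<Longrightarrow> dist s t < e \<Longrightarrow> D s \<noteq> 0 \<and> (D s > 0 \<longleftrightarrow> D t > 0)"
          unfolding eventually_at by blast
        then show thesis using that[of e] \<open>D t \<noteq> 0\<close> by (metis dist_commute)
      qed
      have "ball t (min e1 e2) \<subseteq> {0<..<1}" using e1(2) by (auto simp: subset_iff)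
      moreover have "(\<forall>s\<in>ball t (min e1 e2). D s > 0) \<or> (\<forall>s\<in>ball t (min e1 e2). D s \<le> 0)"
        using e2(2) by (cases "D t > 0") (auto simp: not_less)
      ultimately show ?thesis using e1(1) e2(1) by (intro exI[of _ "min e1 e2"]) auto
    next
      case False
      then have "\<forall>t\<in>{0..1}. D t = 0" using fin by blast
      then show ?thesis using e1 by (intro exI[of _ e1]) (auto simp: subset_iff)
    qed
  qed
  have fr: "finite (frontier {t\<in>dd_dom \<xi>. P (D t)})"
    if P: "(\<forall>x>0. P x) \<and> (\<forall>x\<le>0. \<not> P x) \<or> (\<forall>x>0. \<not> P x) \<and> (\<forall>x\<le>0. P x)" for P :: "real \<Rightarrow> bool"
  proof (rule finite_subset)
    let ?X = "{t\<in>dd_dom \<xi>. P (D t)}"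
    show "frontier ?X \<subseteq> Z \<union> {0, 1}"
    proof (rule subsetI, rule ccontr)
      fix t assume t: "t \<in> frontier ?X" "t \<notin> Z \<union> {0, 1}"
      have "?X \<subseteq> {0..1}" by (auto simp: dd_dom_def)
      then have "closure ?X \<subseteq> {0..1}" by (rule closure_minimal) simp
      then have "t \<in> {0..1}" using t(1) by (auto simp: frontier_def)
      then have t01: "0 < t" "t < 1" using t(2) by auto
      obtain e where e: "e > 0" "ball t e \<subseteq> {0<..<1}"
         "(\<forall>s\<in>ball t e. D s > 0) \<or> (\<forall>s\<in>ball t e. D s \<le> 0)"
        using loc t(2) t01 by blast
      have sub: "ball t e \<subseteq> dd_dom \<xi>" using e(2) domI by (auto simp: subset_iff)
      have "ball t e \<subseteq> ?X \<or> ball t e \<inter> ?X = {}" using P e(3) sub by blast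
      then show False
      proof
        assume "ball t e \<subseteq> ?X"
        then have "t \<in> interior ?X" using e(1) mem_interior by blast
        then show False using t(1) by (simp add: frontier_def)
      next
        assume "ball t e \<inter> ?X = {}"
        then have "ball t e \<inter> closure ?X = {}" by (simp add: open_Int_closure_eq_empty)
        moreover have "t \<in> closure ?X" using t(1) by (simp add: frontier_def)
        ultimately show False using e(1) by (metis IntI centre_in_ball empty_iff)
      qed
    qed
  qed (use finZ in simp)
  have bd: "bounded {t\<in>dd_dom \<xi>. P (D t)}" for P
    by (rule bounded_subset[of "{0..1}"]) (auto simp: dd_dom_def)
  show "finite (components (dd_pos \<xi>))" unfolding pos_eq
    by (intro finite_components_if_finite_frontier bd fr) auto
  show "finite (components (dd_nonpos \<xi>))" unfolding np_eq
    by (intro finite_components_if_finite_frontier bd fr) auto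
  \<comment> \<open>Near \<open>0\<close> the numerator has a constant sign. If it were nonpositive, \<open>\<eta>\<close> would be concave and
    therefore bounded near \<open>0\<close>, contradicting \<open>\<xi>'' \<longlongrightarrow> 0\<close>.\<close>
  have near: "\<exists>\<delta>>0. \<delta> \<le> 1 \<and> {0<..<\<delta>} \<subseteq> dd_pos \<xi>" if z0: "deriv2 \<xi> 0 = 0"
  proof -
    obtain \<delta> where \<delta>: "0 < \<delta>" "\<delta> \<le> 1" "(\<forall>t\<in>{0<..<\<delta>}. D t > 0) \<or> (\<forall>t\<in>{0<..<\<delta>}. D t \<le> 0)"
    proof (cases "finite {t\<in>{0..1}. D t = 0}")
      case True
      then obtain \<delta> where \<delta>: "\<delta> > 0" "\<And>t. t \<in> {t\<in>{0..1}. D t = 0} \<Longrightarrow> t \<noteq> 0 \<Longrightarrow> \<delta> \<le> dist 0 t"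
        using finite_set_avoid[of "{t\<in>{0..1}. D t = 0}" 0] by blast
      define d where "d = min \<delta> 1"
      have d: "0 < d" "d \<le> 1" using \<delta> by (auto simp: d_def)
      have nz: "D t \<noteq> 0" if "t \<in> {0<..<d}" for t
        using \<delta>(2)[of t] that by (auto simp: d_def)
      have "continuous_on {0<..<d} D" using d R
        by (intro continuous_at_imp_continuous_on ballI cD) auto
      then have con: "connected (D ` {0<..<d})" by (intro connected_continuous_image) auto
      have "(\<forall>t\<in>{0<..<d}. D t > 0) \<or> (\<forall>t\<in>{0<..<d}. D t \<le> 0)"
      proof (rule ccontr)
        assume "\<not> ?thesis"
        then obtain p q where pq: "p \<in> {0<..<d}" "q \<in> {0<..<d}" "D p \<le> 0" "D q > 0" by (auto simp: not_le not_less)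
        have "0 \<in> D ` {0<..<d}"
          by (rule connectedD_interval[OF con, of "D p" "D q"]) (use pq in auto)
        then show False using nz by fastforce
      qed
      then show thesis using that d by blast
    next
      case False
      then have "\<forall>t\<in>{0..1}. D t = 0" using fin by blast
      then show thesis using that[of 1] by auto
    qed
    have dom: "t \<in> dd_dom \<xi>" if "t \<in> {0<..<\<delta>}" for t using domI that \<delta>(2) by auto
    have "\<not> (\<forall>t\<in>{0<..<\<delta>}. D t \<le> 0)"
    proof
      assume np: "\<forall>t\<in>{0<..<\<delta>}. D t \<le> 0"
      define p where "p = \<delta> / 2"
      have p: "p \<in> {0<..<\<delta>}" using \<delta> by (auto simp: p_def)
      define M where "M = \<eta> p + \<bar>deriv \<eta> p\<bar> * \<delta>"
      have M: "\<eta> t \<le> M" if t: "t \<in> {0<..<\<delta>}" for t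
      proof -
        have "- deriv \<eta> p * (t - p) \<le> (- \<eta> t) - (- \<eta> p)"
        proof (rule f''_imp_f'[where C = "{0<..<\<delta>}" and f = "\<lambda>t. - \<eta> t" and f' = "\<lambda>t. - deriv \<eta> t" and f'' = "\<lambda>t. - dd \<xi> t"])
          show "((\<lambda>t. - \<eta> t) has_real_derivative - deriv \<eta> x) (at x)" if "x \<in> {0<..<\<delta>}" for x
            by (intro DERIV_minus h1 dom that)
          show "((\<lambda>t. - deriv \<eta> t) has_real_derivative - dd \<xi> x) (at x)" if "x \<in> {0<..<\<delta>}" for x
            by (intro DERIV_minus h2 dom that)
          show "0 \<le> - dd \<xi> x" if "x \<in> {0<..<\<delta>}" for x
          proof -
            have "D x \<le> 0" using np that by blast
            then show ?thesis using sg1[OF dom[OF that]] by auto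
          qed
        qed (use p t in auto)
        then have "\<eta> t \<le> \<eta> p + deriv \<eta> p * (t - p)" by simp
        also have "deriv \<eta> p * (t - p) \<le> \<bar>deriv \<eta> p\<bar> * \<bar>t - p\<bar>" by (metis abs_ge_self abs_mult)
        also have "\<dots> \<le> \<bar>deriv \<eta> p\<bar> * \<delta>" using t p by (intro mult_left_mono) auto
        finally show ?thesis by (simp add: M_def)
      qed
      have eta0: "\<eta> t > 0" if "t \<in> {0<..<\<delta>}" for t using domR[OF dom[OF that]] by (simp add: \<eta>_def)
      have M0: "M > 0" using eta0[OF p] M[OF p] by linarith
      have low: "deriv2 \<xi> t \<ge> 1 / M\<^sup>2" if t: "t \<in> {0<..<\<delta>}" for t
      proof -
        have x: "deriv2 \<xi> t > 0" using domR[OF dom[OF t]] by blast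
        have "1 \<le> M * sqrt (deriv2 \<xi> t)" using M[OF t] x by (simp add: \<eta>_def field_simps)
        then have "1 \<le> (M * sqrt (deriv2 \<xi> t))\<^sup>2" by (rule one_le_power)
        then show ?thesis using x M0 by (simp add: power_mult_distrib field_simps)
      qed
      have "(deriv2 \<xi> \<longlongrightarrow> 0) (at_right 0)"
        using c2[of 0] R z0 by (auto simp: isCont_def filterlim_at_split)
      moreover have "eventually (\<lambda>t. deriv2 \<xi> t \<ge> 1 / M\<^sup>2) (at_right 0)"
        using eventually_at_right_real[OF \<delta>(1)] by (rule eventually_mono) (rule low)
      ultimately have "1 / M\<^sup>2 \<le> 0" by (rule tendsto_lowerbound) simp
      then show False using M0 by simp
    qed
    then have "\<forall>t\<in>{0<..<\<delta>}. D t > 0" using \<delta>(3) by blast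
    then show ?thesis using \<delta> dom unfolding pos_eq by (intro exI[of _ \<delta>]) auto
  qed
  show "deriv2 \<xi> 0 = 0 \<Longrightarrow> \<exists>\<delta>>0. \<delta> \<le> 1 \<and> {0<..<\<delta>} \<subseteq> dd_pos \<xi>" by (rule near)
  have cl: "closed {t\<in>{a..1}. D t \<le> 0}" if "a \<ge> 0" for a
    using that R by (intro continuous_closed_preimage_constant continuous_on_closed_Collect_le continuous_intros
       continuous_at_imp_continuous_on ballI cD) auto
  show "closed (dd_nonpos \<xi>)"
  proof (cases "deriv2 \<xi> 0 = 0")
    case False
    then have "dd_dom \<xi> = {0..1}" using z pos unfolding dd_dom_def by (force simp: order_le_less)
    then show ?thesis using cl[of 0] unfolding np_eq by simp
  next
    case True
    then obtain \<delta> where \<delta>: "\<delta> > 0" "\<delta> \<le> 1" "{0<..<\<delta>} \<subseteq> dd_pos \<xi>" using near by blast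
    have "0 \<notin> dd_dom \<xi>" using True by (simp add: dd_dom_def)
    have "dd_nonpos \<xi> = {t\<in>{\<delta>..1}. D t \<le> 0}"
    proof (intro equalityI subsetI)
      fix t assume t: "t \<in> dd_nonpos \<xi>"
      then have "t \<in> {0..1}" "t \<noteq> 0" "D t \<le> 0" "t \<notin> dd_pos \<xi>"
        using \<open>0 \<notin> dd_dom \<xi>\<close> unfolding np_eq pos_eq by (auto simp: dd_dom_def)
      moreover have "\<delta> \<le> t"
      proof (rule ccontr)
        assume "\<not> \<delta> \<le> t"
        then have "t \<in> {0<..<\<delta>}" using calculation by auto
        then show False using \<delta>(3) calculation by blast
      qed
      ultimately show "t \<in> {t\<in>{\<delta>..1}. D t \<le> 0}" by simp
    next
      fix t assume "t \<in> {t\<in>{\<delta>..1}. D t \<le> 0}"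
      then show "t \<in> dd_nonpos \<xi>" unfolding np_eq using domI \<delta>(1) by auto
    qed
    then show ?thesis using cl[of \<delta>] \<delta> by simp
  qed
qed

section \<open>The function \<open>phi\<close> as an expectation\<close>

lemma Pr01D:
  assumes mu: "\<mu> \<in> Pr01"
  shows "(\<lambda>x. x) \<in> measurable \<mu> borel" "prob_space \<mu>" "space \<mu> = {0..1}"
    "\<And>A. A \<in> sets \<mu> \<longleftrightarrow> A \<in> sets borel \<and> A \<subseteq> {0..1}"
proof -
  show s: "prob_space \<mu>" "space \<mu> = {0..1}" using mu by (auto simp: Pr01_def)
  have st: "sets \<mu> = sets (restrict_space borel {0..1::real})" using mu by (auto simp: Pr01_def)
  show "(\<lambda>x. x) \<in> measurable \<mu> borel"
    unfolding measurable_cong_sets[OF st refl] by (rule measurable_restrict_space1) simp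
  show "A \<in> sets \<mu> \<longleftrightarrow> A \<in> sets borel \<and> A \<subseteq> {0..1}" for A
    unfolding st by (subst sets_restrict_space_iff) auto
qed

text \<open>
  Regarding \<open>\<mu>\<close> as a measure on the whole line makes the theory of distribution functions available.
\<close>

definition embed :: "real measure \<Rightarrow> real measure" where
  "embed \<mu> = distr \<mu> borel (\<lambda>x. x)"

lemma embed_facts:
  assumes mu: "\<mu> \<in> Pr01"
  shows "real_distribution (embed \<mu>)"
    and "\<And>A. A \<in> sets borel \<Longrightarrow> emeasure (embed \<mu>) A = emeasure \<mu> (A \<inter> {0..1})"
    and "\<And>A. A \<in> sets \<mu> \<Longrightarrow> emeasure \<mu> A = emeasure (embed \<mu>) A"
    and "AE x in embed \<mu>. x \<in> {0..1}"
    and "\<And>s. s \<le> 1 \<Longrightarrow> measure \<mu> {0..s} = cdf (embed \<mu>) s"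
proof -
  note P = Pr01D[OF mu]
  interpret prob_space \<mu> by (rule P)
  show "real_distribution (embed \<mu>)"
    unfolding embed_def using P(1) by (intro real_distribution_distr) auto
  show e: "emeasure (embed \<mu>) A = emeasure \<mu> (A \<inter> {0..1})" if "A \<in> sets borel" for A
    unfolding embed_def by (subst emeasure_distr[OF P(1) that]) (simp add: P(3) Int_def vimage_def)
  show "emeasure \<mu> A = emeasure (embed \<mu>) A" if "A \<in> sets \<mu>" for A
    using that e[of A] P(4)[of A] by (auto simp: Int_absorb2)
  show "AE x in embed \<mu>. x \<in> {0..1}"
    unfolding embed_def by (subst AE_distr_iff[OF P(1)]) (auto intro!: AE_I2 simp del: atLeastAtMost_iff simp: P(3))
  show "measure \<mu> {0..s} = cdf (embed \<mu>) s" if "s \<le> 1" for s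
  proof -
    have "{..s} \<inter> {0..1} = {0..s}" using that by auto
    then have "emeasure (embed \<mu>) {..s} = emeasure \<mu> {0..s}"
      using e[of "{..s}"] by (metis atMost_borel)
    then show ?thesis unfolding cdf_def measure_def by simp
  qed
qed

context
  fixes \<mu> :: "real measure"
  assumes mu: "\<mu> \<in> Pr01"
begin

interpretation M: real_distribution "embed \<mu>" by (rule embed_facts[OF mu])

lemma integrable_one_minus_max: "t \<in> {0..1} \<Longrightarrow> integrable (embed \<mu>) (\<lambda>x. 1 - max x t)"
  by (rule M.integrable_const_bound[where B = 1])
     (auto intro!: eventually_mono[OF embed_facts(4)[OF mu]])

text \<open>
  Since \<open>\<mu> [0, s]\<close> is the integral of \<open>indicator {..s}\<close> against \<open>\<mu>\<close>, exchanging the integrals exhibits \<open>phi\<close> as a mixture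
  of the functions belonging to Dirac measures. Concavity and the slope bounds below hold for each of
  these functions and pass to the mixture.
\<close>

lemma phi_eq_expectation:
  assumes t: "t \<in> {0..1}"
  shows "phi \<mu> t = (\<integral>x. 1 - max x t \<partial>embed \<mu>)"
proof -
  interpret P: pair_sigma_finite lborel "embed \<mu>" ..
  let ?f = "\<lambda>s x. indicator {t..1} s * indicator {..s} x :: real"
  have "phi \<mu> t = (\<integral>s. (\<integral>x. ?f s x \<partial>embed \<mu>) \<partial>lborel)"
    unfolding phi_def set_lebesgue_integral_def
  proof (rule Bochner_Integration.integral_cong[OF refl])
    fix s :: real
    show "indicator {t..1} s *\<^sub>R measure \<mu> {0..s} = (\<integral>x. ?f s x \<partial>embed \<mu>)"
      using embed_facts(5)[OF mu, of s] by (auto simp: cdf_def split: split_indicator)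
  qed
  also have "\<dots> = (\<integral>x. (\<integral>s. ?f s x \<partial>lborel) \<partial>embed \<mu>)"
  proof (rule P.Fubini_integral[symmetric])
    have m: "(\<lambda>z. case z of (s, x) \<Rightarrow> ?f s x) \<in> borel_measurable (lborel \<Otimes>\<^sub>M embed \<mu>)"
    proof -
      have "(\<lambda>z. if fst z \<in> {t..1} \<and> snd z \<le> fst z then 1 else 0 :: real) \<in> borel_measurable (lborel \<Otimes>\<^sub>M embed \<mu>)"
        by measurable
      then show ?thesis by (rule measurable_cong[THEN iffD1, rotated]) (auto split: split_indicator)
    qed
    show "integrable (lborel \<Otimes>\<^sub>M embed \<mu>) (\<lambda>(s, x). ?f s x)"
    proof (rule integrableI_bounded_set[where A = "{t..1} \<times> UNIV" and B = 1])
      show "emeasure (lborel \<Otimes>\<^sub>M embed \<mu>) ({t..1} \<times> UNIV) < \<infinity>"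
        by (subst M.emeasure_pair_measure_Times) (auto simp: ennreal_mult_less_top emeasure_lborel_Icc_eq M.emeasure_eq_measure)
    qed (use m in \<open>auto intro!: AE_I2 simp: indicator_def split: if_splits\<close>)
  qed
  also have "\<dots> = (\<integral>x. 1 - max x t \<partial>embed \<mu>)"
  proof (rule integral_cong_AE)
    show "(\<lambda>x. \<integral>s. ?f s x \<partial>lborel) \<in> borel_measurable (embed \<mu>)"
    proof (rule lborel.borel_measurable_lebesgue_integral)
      have "(\<lambda>z. if snd z \<in> {t..1} \<and> fst z \<le> snd z then 1 else 0 :: real) \<in> borel_measurable (embed \<mu> \<Otimes>\<^sub>M lborel)"
        by measurable
      then show "(\<lambda>(x, s). ?f s x) \<in> borel_measurable (embed \<mu> \<Otimes>\<^sub>M lborel)"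
        by (rule measurable_cong[THEN iffD1, rotated]) (auto split: split_indicator)
    qed
    show "AE x in embed \<mu>. (\<integral>s. ?f s x \<partial>lborel) = 1 - max x t"
      using embed_facts(4)[OF mu]
    proof eventually_elim
      case (elim x)
      have "(\<integral>s. ?f s x \<partial>lborel) = (\<integral>s. indicator {max x t..1} s \<partial>lborel)"
        by (rule Bochner_Integration.integral_cong) (auto split: split_indicator)
      then show ?case using elim t by simp
    qed
  qed simp
  finally show ?thesis .
qed

text \<open>
  The difference is the average of \<open>max x t - max x s\<close>, which is \<open>t - s\<close> for \<open>x \<le> s\<close>, zero for \<open>x \<ge> t\<close>, and in
  between for the remaining \<open>x\<close>.
\<close>

lemma phi_diff_bounds:
  assumes "0 \<le> s" "s \<le> t" "t \<le> 1"
  shows "cdf (embed \<mu>) s * (t - s) \<le> phi \<mu> s - phi \<mu> t"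
    and "phi \<mu> s - phi \<mu> t \<le> measure (embed \<mu>) {..<t} * (t - s)"
proof -
  have i: "integrable (embed \<mu>) (\<lambda>x. max x t - max x s)"
    using Bochner_Integration.integrable_diff[OF integrable_one_minus_max[of s] integrable_one_minus_max[of t]] assms by simp
  have "phi \<mu> s - phi \<mu> t = (\<integral>x. (1 - max x s) - (1 - max x t) \<partial>embed \<mu>)"
    using assms by (subst Bochner_Integration.integral_diff) (auto simp: phi_eq_expectation integrable_one_minus_max)
  then have e: "phi \<mu> s - phi \<mu> t = (\<integral>x. max x t - max x s \<partial>embed \<mu>)" by simp
  have ii: "integrable (embed \<mu>) (\<lambda>x. indicator A x * c)" if "A \<in> sets borel" for A and c :: real
    using that
    by (intro integrable_mult_left M.integrable_const_bound[where B = 1]) (auto split: split_indicator)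
  have "cdf (embed \<mu>) s * (t - s) = (\<integral>x. indicator {..s} x * (t - s) \<partial>embed \<mu>)"
    by (simp add: cdf_def)
  also have "\<dots> \<le> (\<integral>x. max x t - max x s \<partial>embed \<mu>)"
    using assms by (intro integral_mono i ii) (auto split: split_indicator)
  finally show "cdf (embed \<mu>) s * (t - s) \<le> phi \<mu> s - phi \<mu> t" by (simp add: e)
  have "(\<integral>x. max x t - max x s \<partial>embed \<mu>) \<le> (\<integral>x. indicator {..<t} x * (t - s) \<partial>embed \<mu>)"
    using assms by (intro integral_mono i ii) (auto split: split_indicator)
  also have "\<dots> = measure (embed \<mu>) {..<t} * (t - s)" by simp
  finally show "phi \<mu> s - phi \<mu> t \<le> measure (embed \<mu>) {..<t} * (t - s)" by (simp add: e)
qed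

lemma phi_1: "phi \<mu> 1 = 0"
proof -
  have "(\<integral>x. 1 - max x 1 \<partial>embed \<mu>) = (\<integral>x. 0 \<partial>embed \<mu>)"
    by (rule integral_cong_AE) (auto intro!: eventually_mono[OF embed_facts(4)[OF mu]])
  then show ?thesis by (simp add: phi_eq_expectation)
qed

lemma phi_bounds:
  assumes "t \<in> {0..1}" shows "0 \<le> phi \<mu> t" "phi \<mu> t \<le> 1 - t"
proof -
  have "0 \<le> cdf (embed \<mu>) t * (1 - t)" using assms by (simp add: M.cdf_nonneg)
  then show "0 \<le> phi \<mu> t" using phi_diff_bounds(1)[of t 1] phi_1 assms by simp
  have "measure (embed \<mu>) {..<1} * (1 - t) \<le> 1 * (1 - t)"
    using assms by (intro mult_right_mono) auto
  then show "phi \<mu> t \<le> 1 - t" using phi_diff_bounds(2)[of t 1] phi_1 assms by simp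
qed

lemma phi_lipschitz:
  assumes "s \<in> {0..1}" "t \<in> {0..1}" shows "\<bar>phi \<mu> s - phi \<mu> t\<bar> \<le> \<bar>s - t\<bar>"
proof -
  have *: "\<bar>phi \<mu> s - phi \<mu> t\<bar> \<le> t - s" if "0 \<le> s" "s \<le> t" "t \<le> 1" for s t
  proof -
    have "measure (embed \<mu>) {..<t} * (t - s) \<le> 1 * (t - s)"
      using that by (intro mult_right_mono) auto
    moreover have "0 \<le> cdf (embed \<mu>) s * (t - s)" using that by (simp add: M.cdf_nonneg)
    ultimately show ?thesis using phi_diff_bounds[OF that] by simp
  qed
  show ?thesis using *[of s t] *[of t s] assms by (cases "s \<le> t") (auto simp: abs_minus_commute)
qed

lemma continuous_on_phi: "continuous_on {0..1} (phi \<mu>)"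
  unfolding continuous_on_iff dist_real_def
  using phi_lipschitz by (metis abs_minus_commute le_less_trans)

lemma concave_on_phi: "concave_on {0..1} (phi \<mu>)"
  unfolding concave_on_iff
proof (intro conjI ballI allI impI)
  fix s t u v :: real assume st: "s \<in> {0..1}" "t \<in> {0..1}" and uv: "0 \<le> u" "0 \<le> v" "u + v = 1"
  have w: "u *\<^sub>R s + v *\<^sub>R t \<in> {0..1}"
    using convexD[OF convex_real_interval(5)[of 0 1] st uv] by simp
  have "u * phi \<mu> s + v * phi \<mu> t = (\<integral>x. u * (1 - max x s) + v * (1 - max x t) \<partial>embed \<mu>)"
    using st by (simp add: phi_eq_expectation integrable_one_minus_max)
  also have "\<dots> \<le> (\<integral>x. 1 - max x (u *\<^sub>R s + v *\<^sub>R t) \<partial>embed \<mu>)"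
  proof (intro integral_mono Bochner_Integration.integrable_add integrable_mult_right integrable_one_minus_max st w)
    fix x
    have "u * x \<le> u * max x s" "u * s \<le> u * max x s" "v * x \<le> v * max x t" "v * t \<le> v * max x t"
      using uv by (auto intro: mult_left_mono)
    moreover have "x = u * x + v * x" using uv by (simp add: distrib_right[symmetric])
    ultimately have "max x (u * s + v * t) \<le> u * max x s + v * max x t" by linarith
    moreover have "u * (1 - max x s) + v * (1 - max x t) = u + v - (u * max x s + v * max x t)" by (simp add: algebra_simps)
    ultimately show "u * (1 - max x s) + v * (1 - max x t) \<le> 1 - max x (u *\<^sub>R s + v *\<^sub>R t)"
      using uv by (simp only: real_scaleR_def)
  qed
  also have "\<dots> = phi \<mu> (u *\<^sub>R s + v *\<^sub>R t)" using w by (simp add: phi_eq_expectation)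
  finally show "phi \<mu> (u *\<^sub>R s + v *\<^sub>R t) \<ge> u * phi \<mu> s + v * phi \<mu> t" .
qed simp

lemma phi_lower: "t \<in> {0..1} \<Longrightarrow> phi \<mu> t \<ge> phi \<mu> 0 * (1 - t)"
  using concave_onD[OF concave_on_phi, of t 0 1] phi_1 by (simp add: mult.commute)

lemma phi_affine_on_gap:
  assumes "0 \<le> u" "v \<le> 1" and gap: "measure (embed \<mu>) {u<..<v} = 0" and s: "u \<le> s" "s \<le> v"
  shows "phi \<mu> s = phi \<mu> u - cdf (embed \<mu>) u * (s - u)"
proof (cases "s = u")
  case False
  then have "u < s" using s by simp
  have "{..<s} \<subseteq> {..u} \<union> {u<..<v}" using s by auto
  then have "measure (embed \<mu>) {..<s} \<le> measure (embed \<mu>) ({..u} \<union> {u<..<v})"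
    by (intro M.finite_measure_mono) auto
  also have "\<dots> \<le> measure (embed \<mu>) {..u} + measure (embed \<mu>) {u<..<v}"
    by (rule measure_Un_le) auto
  finally have "measure (embed \<mu>) {..<s} \<le> cdf (embed \<mu>) u" using gap by (simp add: cdf_def)
  then have "measure (embed \<mu>) {..<s} * (s - u) \<le> cdf (embed \<mu>) u * (s - u)"
    using \<open>u < s\<close> by (intro mult_right_mono) auto
  then show ?thesis using phi_diff_bounds[of u s] assms by simp
qed simp

text \<open>The perturbations of the minimizer from which the first-order condition is derived.\<close>

lemma exists_mixture_with_dirac:
  assumes x: "x \<in> {0..1}" and e: "0 \<le> e" "e \<le> 1"
  shows "\<exists>\<nu>\<in>Pr01. \<forall>t\<in>{0..1}. phi \<nu> t = (1 - e) * phi \<mu> t + e * (1 - max x t)"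
proof -
  note P = Pr01D[OF mu]
  interpret p: prob_space \<mu> by (rule P)
  define \<delta> where "\<delta> = return \<mu> x"
  interpret d: prob_space \<delta> unfolding \<delta>_def by (rule prob_space_return) (use P x in simp)
  define g where "g = (\<lambda>A. ennreal (1 - e) * emeasure \<mu> A + ennreal e * emeasure \<delta> A)"
  define \<nu> where "\<nu> = measure_of (space \<mu>) (sets \<mu>) g"
  have sets\<nu>: "sets \<nu> = sets \<mu>" "space \<nu> = space \<mu>" by (simp_all add: \<nu>_def sets.space_closed space_measure_of_conv)
  have em: "emeasure \<nu> A = g A" if "A \<in> sets \<mu>" for A
    unfolding \<nu>_def
  proof (rule emeasure_measure_of_sigma[OF _ _ _ that])
    show "sigma_algebra (space \<mu>) (sets \<mu>)" by (rule sets.sigma_algebra_axioms)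
    show "positive (sets \<mu>) g" by (simp add: positive_def g_def)
    show "countably_additive (sets \<mu>) g"
      unfolding countably_additive_def
    proof (intro allI impI)
      fix A :: "nat \<Rightarrow> real set" assume A: "range A \<subseteq> sets \<mu>" "disjoint_family A" "\<Union>(range A) \<in> sets \<mu>"
      have sd: "range A \<subseteq> sets \<delta>" using A by (simp add: \<delta>_def)
      have "(\<Sum>i. g (A i)) = (\<Sum>i. ennreal (1 - e) * emeasure \<mu> (A i)) + (\<Sum>i. ennreal e * emeasure \<delta> (A i))"
        unfolding g_def by (rule suminf_add[symmetric]) auto
      also have "\<dots> = ennreal (1 - e) * (\<Sum>i. emeasure \<mu> (A i)) + ennreal e * (\<Sum>i. emeasure \<delta> (A i))"
        by simp
      also have "\<dots> = g (\<Union>(range A))"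
        unfolding g_def suminf_emeasure[OF A(1,2)] suminf_emeasure[OF sd A(2)] ..
      finally show "(\<Sum>i. g (A i)) = g (\<Union>(range A))" .
    qed
  qed
  have dA: "emeasure \<delta> A = indicator A x" if "A \<in> sets \<mu>" for A
    using that by (simp add: \<delta>_def)
  have "prob_space \<nu>"
  proof
    have "emeasure \<nu> (space \<nu>) = g (space \<mu>)" using em sets\<nu> by simp
    also have "\<dots> = ennreal (1 - e) + ennreal e"
      using d.emeasure_space_1 p.emeasure_space_1 by (simp add: g_def \<delta>_def)
    also have "\<dots> = 1" using e by (simp add: ennreal_plus[symmetric] del: ennreal_plus)
    finally show "emeasure \<nu> (space \<nu>) = 1" .
  qed
  then have nu: "\<nu> \<in> Pr01" using mu by (simp add: Pr01_def sets\<nu>)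
  have meas: "measure \<nu> {0..s} = (1 - e) * measure \<mu> {0..s} + e * indicator {x..} s" if "s \<le> 1" for s
  proof -
    have A: "{0..s} \<in> sets \<mu>" using that by (simp add: P(4))
    have "emeasure \<nu> {0..s} = ennreal (1 - e) * ennreal (measure \<mu> {0..s}) + ennreal e * ennreal (indicator {x..} s)"
      using em[OF A] dA[OF A] x by (auto simp: g_def p.emeasure_eq_measure split: split_indicator)
    also have "\<dots> = ennreal ((1 - e) * measure \<mu> {0..s} + e * indicator {x..} s)"
      using e by (simp add: ennreal_mult)
    finally show ?thesis
      unfolding measure_def[of \<nu>] using e by (metis add_nonneg_nonneg diff_ge_0_iff_ge enn2real_ennreal indicator_pos_le measure_nonneg mult_nonneg_nonneg)
  qed
  have "phi \<nu> t = (1 - e) * phi \<mu> t + e * (1 - max x t)" if t: "t \<in> {0..1}" for t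
  proof -
    have i1: "set_integrable lborel {t..1} (\<lambda>s. measure \<mu> {0..s})"
    proof -
      have cm: "cdf (embed \<mu>) \<in> borel_measurable borel"
        by (rule borel_measurable_mono) (simp add: mono_def M.cdf_nondecreasing)
      have "set_integrable lborel {t..1} (cdf (embed \<mu>))"
        unfolding set_integrable_def
        by (rule integrableI_bounded_set[where A = "{t..1}" and B = 1])
           (use cm in \<open>auto simp: emeasure_lborel_Icc_eq M.cdf_nonneg M.cdf_bounded_prob split: split_indicator\<close>)
      then show ?thesis
        by (rule set_integrable_cong[THEN iffD1, rotated -1]) (auto simp: embed_facts(5)[OF mu])
    qed
    have i2: "set_integrable lborel {t..1} (\<lambda>s. indicator {x..} s :: real)"
      unfolding set_integrable_def
        by (rule integrableI_bounded_set[where A = "{t..1}" and B = 1])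
           (auto simp: emeasure_lborel_Icc_eq split: split_indicator)
    have "phi \<nu> t = (LINT s:{t..1}|lborel. (1 - e) * measure \<mu> {0..s} + e * indicator {x..} s)"
      unfolding phi_def by (intro set_lebesgue_integral_cong) (auto simp: meas)
    also have "\<dots> = (1 - e) * phi \<mu> t + e * (LINT s:{t..1}|lborel. indicator {x..} s)"
      unfolding phi_def using i1 i2 by (subst set_integral_add(2)) auto
    also have "(LINT s:{t..1}|lborel. indicator {x..} s) = (\<integral>s. indicator {max x t..1} s \<partial>lborel)"
      unfolding set_lebesgue_integral_def
      by (rule Bochner_Integration.integral_cong) (auto split: split_indicator)
    finally show ?thesis using t x by simp
  qed
  then show ?thesis using nu by blast
qed

end

section \<open>The first-order condition\<close>

abbreviation I01 :: "real set" where "I01 \<equiv> {0..<1}"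

lemma set_borel_measurable_I01:
  fixes f :: "real \<Rightarrow> real"
  assumes "continuous_on I01 f"
  shows "set_borel_measurable lborel I01 f"
  using borel_measurable_continuous_on_indicator[OF _ assms]
  by (simp add: set_borel_measurable_def)

lemma set_lebesgue_integral_Icc_Ico:
  fixes f :: "real \<Rightarrow> real"
  shows "(LINT s:{0..1}|lborel. f s) = (LINT s:I01|lborel. f s)"
  unfolding set_lebesgue_integral_def
  by (rule integral_discrete_difference[where X = "{1}"]) (auto split: split_indicator)

lemma set_integrable_I01_bounded:
  fixes f :: "real \<Rightarrow> real"
  assumes "continuous_on I01 f" "\<And>s. s \<in> I01 \<Longrightarrow> \<bar>f s\<bar> \<le> B"
  shows "set_integrable lborel I01 f"
proof -
  have "set_integrable lborel I01 (\<lambda>_. B)" by (simp add: set_integrable_def)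
  then show ?thesis
    by (rule set_integrable_bound[OF _ set_borel_measurable_I01[OF assms(1)]])
       (use assms(2) in \<open>fastforce intro!: AE_I2\<close>)
qed

lemma set_integrable_I01_dominated:
  fixes f g :: "real \<Rightarrow> real"
  assumes "set_integrable lborel I01 g" "continuous_on I01 f" "\<And>s. s \<in> I01 \<Longrightarrow> \<bar>f s\<bar> \<le> g s"
  shows "set_integrable lborel I01 f"
  by (rule set_integrable_bound[OF assms(1) set_borel_measurable_I01[OF assms(2)]])
     (use assms(3) in \<open>fastforce intro!: AE_I2\<close>)

text \<open>
  An atom of \<open>\<mu>\<close> at \<open>1\<close> would make the energy density at least of this size; the divergence shows that
  a measure of finite energy has no such atom.
\<close>

lemma not_set_integrable_inverse:
  assumes "c > 0" shows "\<not> set_integrable lborel I01 (\<lambda>s. c / (1 - s))"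
proof
  assume i: "set_integrable lborel I01 (\<lambda>s. c / (1 - s))"
  define L where "L = (LINT s:I01|lborel. c / (1 - s))"
  have "- c * ln (1 - t) \<le> L" if t: "0 \<le> t" "t < 1" for t
  proof -
    have "(\<integral>s. indicator {0..t} s *\<^sub>R (c / (1 - s)) \<partial>lborel) = (- c * ln (1 - t)) - (- c * ln (1 - 0))"
      using t by (intro integral_FTC_Icc)
         (auto intro!: derivative_eq_intros continuous_intros simp: has_real_derivative_iff_has_vector_derivative[symmetric] field_simps)
    then have "- c * ln (1 - t) = (\<integral>s. indicator {0..t} s *\<^sub>R (c / (1 - s)) \<partial>lborel)" by simp
    also have "\<dots> \<le> L"
    proof -
      have "set_integrable lborel {0..t} (\<lambda>s. c / (1 - s))"
        by (rule set_integrable_subset[OF i]) (use t in auto)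
      then show ?thesis
        unfolding L_def set_lebesgue_integral_def using i assms t
        by (intro integral_mono) (auto simp: set_integrable_def split: split_indicator)
    qed
    finally show ?thesis .
  qed
  note b = this
  define y where "y = (- \<bar>L\<bar> - 1) / c"
  have "y \<le> 0" using assms by (simp add: y_def divide_nonpos_pos)
  then have "- c * ln (1 - (1 - exp y)) \<le> L" by (intro b) auto
  then have "- (c * y) \<le> L" by simp
  then have "\<bar>L\<bar> + 1 \<le> L" using assms by (simp add: y_def)
  then show False by linarith
qed

definition energy_density :: "real measure \<Rightarrow> real \<Rightarrow> real" where
  "energy_density \<mu> s = 1 / phi \<mu> s - 1 / (1 - s)"

text \<open>
  Translates the extended-real functional into Bochner integrals, in which differences can be formed.
\<close>

lemma crisanti_sommers_real:
  assumes mu: "\<mu> \<in> Pr01" and pos: "\<And>s. s \<in> I01 \<Longrightarrow> phi \<mu> s > 0"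
  shows "crisanti_sommers \<xi> h \<mu> < \<infinity> \<Longrightarrow> set_integrable lborel I01 (energy_density \<mu>)"
    and "set_integrable lborel I01 (energy_density \<mu>) \<Longrightarrow>
       crisanti_sommers \<xi> h \<mu> = ereal (1/2 * ((LINT s:I01|lborel. deriv2 \<xi> s * phi \<mu> s)
         + (LINT s:I01|lborel. energy_density \<mu> s) + h\<^sup>2 * phi \<mu> 0))"
proof -
  let ?e = "\<lambda>s. indicator I01 s *\<^sub>R energy_density \<mu> s"
  have nn: "energy_density \<mu> s \<ge> 0" if "s \<in> I01" for s
    unfolding energy_density_def using pos[OF that] phi_bounds[OF mu, of s] that
    by (auto simp: divide_simps)
  have "(\<integral>\<^sup>+s\<in>{0..1}. (1 / ennreal (phi \<mu> s) - 1 / ennreal (1 - s)) \<partial>lborel) = (\<integral>\<^sup>+s. ennreal (?e s) \<partial>lborel)"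
  proof (rule nn_integral_cong_AE)
    have "AE s in lborel. s \<noteq> (1::real)" by (rule AE_lborel_singleton)
    then show "AE s in lborel. (1 / ennreal (phi \<mu> s) - 1 / ennreal (1 - s)) * indicator {0..1} s = ennreal (?e s)"
    proof (rule eventually_mono)
      fix s :: real assume s: "s \<noteq> 1"
      show "(1 / ennreal (phi \<mu> s) - 1 / ennreal (1 - s)) * indicator {0..1} s = ennreal (?e s)"
      proof (cases "s \<in> I01")
        case True
        then have "1 / ennreal (phi \<mu> s) = ennreal (1 / phi \<mu> s)" "1 / ennreal (1 - s) = ennreal (1 / (1 - s))"
          using pos[OF True] divide_ennreal[of 1] by (simp_all add: ennreal_1[symmetric] del: ennreal_1)
        then show ?thesis using True by (simp add: energy_density_def ennreal_minus)
      next
        case False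
        then show ?thesis using s by (auto split: split_indicator)
      qed
    qed
  qed
  then have cs: "crisanti_sommers \<xi> h \<mu> = ereal (1/2) *
     (ereal (LINT s:I01|lborel. deriv2 \<xi> s * phi \<mu> s) + enn2ereal (\<integral>\<^sup>+s. ennreal (?e s) \<partial>lborel)
       + ereal (h\<^sup>2 * phi \<mu> 0))"
    unfolding crisanti_sommers_def set_lebesgue_integral_Icc_Ico by simp
  have c: "continuous_on I01 (energy_density \<mu>)"
    unfolding energy_density_def using pos
    by (intro continuous_intros continuous_on_subset[OF continuous_on_phi[OF mu]]) force+
  have m: "?e \<in> borel_measurable lborel"
    using set_borel_measurable_I01[OF c] by (simp add: set_borel_measurable_def)
  show "set_integrable lborel I01 (energy_density \<mu>)" if "crisanti_sommers \<xi> h \<mu> < \<infinity>"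
  proof -
    have "(\<integral>\<^sup>+s. ennreal (?e s) \<partial>lborel) < \<infinity>"
    proof (rule ccontr)
      assume "\<not> ?thesis"
      then have "(\<integral>\<^sup>+s. ennreal (?e s) \<partial>lborel) = \<infinity>" by (simp add: less_top[symmetric])
      then show False using that unfolding cs by simp
    qed
    moreover have "(\<integral>\<^sup>+s. ennreal (norm (?e s)) \<partial>lborel) = (\<integral>\<^sup>+s. ennreal (?e s) \<partial>lborel)"
      using nn by (intro nn_integral_cong) (auto split: split_indicator)
    ultimately show ?thesis
      unfolding set_integrable_def integrable_iff_bounded using m by simp
  qed
  show "crisanti_sommers \<xi> h \<mu> = ereal (1/2 * ((LINT s:I01|lborel. deriv2 \<xi> s * phi \<mu> s)
         + (LINT s:I01|lborel. energy_density \<mu> s) + h\<^sup>2 * phi \<mu> 0))"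
    if i: "set_integrable lborel I01 (energy_density \<mu>)"
  proof -
    have nne: "0 \<le> ?e s" for s using nn by (auto split: split_indicator)
    have "(\<integral>\<^sup>+s. ennreal (?e s) \<partial>lborel) = ennreal (LINT s:I01|lborel. energy_density \<mu> s)"
      unfolding set_lebesgue_integral_def using i nne
      by (intro nn_integral_eq_integral) (auto simp: set_integrable_def)
    moreover have "(LINT s:I01|lborel. energy_density \<mu> s) \<ge> 0"
      unfolding set_lebesgue_integral_def using nne by (intro integral_nonneg_AE) auto
    ultimately show ?thesis unfolding cs by (simp add: enn2ereal_ennreal)
  qed
qed

text \<open>
  Since \<open>phi\<close> is nonnegative and nonincreasing, it can vanish at \<open>0\<close> only if it vanishes identically, and then
  the energy is infinite.
\<close>

lemma phi_0_pos:
  assumes mu: "\<mu> \<in> Pr01" and fin: "crisanti_sommers \<xi> h \<mu> < \<infinity>"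
  shows "phi \<mu> 0 > 0"
proof (rule ccontr)
  assume "\<not> phi \<mu> 0 > 0"
  then have z0: "phi \<mu> 0 = 0" using phi_bounds[OF mu, of 0] by simp
  interpret M: real_distribution "embed \<mu>" by (rule embed_facts[OF mu])
  have z: "phi \<mu> s = 0" if "s \<in> {0..1}" for s
    using phi_diff_bounds(1)[OF mu, of 0 s] that z0 phi_bounds[OF mu that] M.cdf_nonneg[of 0]
    by (smt (verit) atLeastAtMost_iff mult_nonneg_nonneg)
  have "\<infinity> = (\<integral>\<^sup>+s. \<infinity> * indicator {0..<1::real} s \<partial>lborel)"
    by (subst nn_integral_cmult_indicator) auto
  also have "\<dots> \<le> (\<integral>\<^sup>+s\<in>{0..1}. (1 / ennreal (phi \<mu> s) - 1 / ennreal (1 - s)) \<partial>lborel)"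
    by (rule nn_integral_mono) (auto simp: z split: split_indicator)
  finally have "(\<integral>\<^sup>+s\<in>{0..1}. (1 / ennreal (phi \<mu> s) - 1 / ennreal (1 - s)) \<partial>lborel) = \<infinity>"
    by (simp add: top_unique)
  then show False using fin unfolding crisanti_sommers_def by simp
qed

lemma Pr01_nonempty: "return (restrict_space borel {0..1}) 0 \<in> Pr01"
  unfolding Pr01_def by (auto intro!: prob_space_return simp: space_restrict_space)

lemma exists_dirac:
  assumes x: "x \<in> {0..1}"
  shows "\<exists>\<nu>\<in>Pr01. \<forall>t\<in>{0..1}. phi \<nu> t = 1 - max x t"
  using exists_mixture_with_dirac[OF Pr01_nonempty x, of 1] by simp

text \<open>The Dirac measure at \<open>0\<close> has energy density zero and serves as a competitor.\<close>

lemma minimizer_energy_finite: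
  assumes mu: "\<mu> \<in> Pr01" and min: "\<And>\<nu>. \<nu> \<in> Pr01 \<Longrightarrow> crisanti_sommers \<xi> h \<mu> \<le> crisanti_sommers \<xi> h \<nu>"
  shows "crisanti_sommers \<xi> h \<mu> < \<infinity>"
proof -
  obtain \<nu> where nu: "\<nu> \<in> Pr01" "\<And>t. t \<in> {0..1} \<Longrightarrow> phi \<nu> t = 1 - max 0 t"
    using exists_dirac[of 0] by auto
  have p: "phi \<nu> s > 0" if "s \<in> I01" for s using nu(2)[of s] that by simp
  have z: "energy_density \<nu> s = 0" if "s \<in> I01" for s
    using nu(2)[of s] that by (simp add: energy_density_def max_absorb2)
  have "continuous_on I01 (energy_density \<nu>)"
    by (rule continuous_on_eq[where f = "\<lambda>_. 0"]) (auto simp: z)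
  then have "set_integrable lborel I01 (energy_density \<nu>)"
    by (rule set_integrable_I01_bounded[where B = 0]) (simp add: z)
  from crisanti_sommers_real(2)[OF nu(1) p this] have "crisanti_sommers \<xi> h \<nu> < \<infinity>" by simp
  then show ?thesis using min[OF nu(1)] by (rule le_less_trans[rotated])
qed

text \<open>
  For \<open>\<nu> = (1 - e) \<mu> + e \<delta>\<^sub>x\<close> with function \<open>phi \<nu> = \<phi> - e * d\<close> one has
  \<open>1 / phi \<nu> = 1 / \<phi> + e * d / \<phi>\<^sup>2 + e\<^sup>2 * d\<^sup>2 / (\<phi>\<^sup>2 * phi \<nu>)\<close>, so that minimality gives
  \<open>0 \<le> e * A + e\<^sup>2 * B\<close> for all small \<open>e\<close>, where the linear term \<open>A\<close> equals \<open>K x - k\<close> with \<open>k\<close> independent of \<open>x\<close>. Averaging \<open>K\<close> over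
  \<open>\<mu>\<close> by Fubini's theorem gives exactly \<open>k\<close>, which forces \<open>K = k\<close> almost everywhere.

  The integrals converge near \<open>1\<close> for the following reason. Put \<open>\<psi> s = 1 - s - \<phi> s\<close> and \<open>c = \<phi> 0\<close>. Concavity
  gives \<open>c * (1 - s) \<le> \<phi> s \<le> 1 - s\<close>, and \<open>\<psi> / (1 - s)\<^sup>2\<close> is at most the energy density, hence
  integrable. Both \<open>d / \<phi>\<^sup>2\<close> and the quadratic remainder are dominated by \<open>(\<psi> s + max 0 (x - s)) / (1 - s)\<^sup>2\<close>,
  whose second summand vanishes for \<open>s > x\<close>.
\<close>

lemma euler_lagrange:
  fixes \<xi> :: "real \<Rightarrow> real"
  assumes mu: "\<mu> \<in> Pr01"
    and min: "\<And>\<nu>. \<nu> \<in> Pr01 \<Longrightarrow> crisanti_sommers \<xi> h \<mu> \<le> crisanti_sommers \<xi> h \<nu>"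
    and cont: "continuous_on {0..1} (deriv2 \<xi>)"
  defines "W \<equiv> (\<lambda>s. 1 / (phi \<mu> s)\<^sup>2 - deriv2 \<xi> s)"
  defines "K \<equiv> (\<lambda>x. (LINT s:I01|lborel. W s * max 0 (x - s)) - h\<^sup>2 * x)"
  shows "\<exists>k. (\<forall>x\<in>I01. k \<le> K x) \<and> (AE x in embed \<mu>. x \<in> I01 \<and> K x = k)"
proof -
  interpret M: real_distribution "embed \<mu>" by (rule embed_facts[OF mu])
  define \<phi> where "\<phi> = phi \<mu>"
  define X where "X = deriv2 \<xi>"
  define c where "c = \<phi> 0"
  define \<psi> where "\<psi> = (\<lambda>s. 1 - s - \<phi> s)"
  note fin = minimizer_energy_finite[OF mu min]
  have c: "c > 0" using phi_0_pos[OF mu fin] by (simp add: c_def \<phi>_def)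
  have low: "\<phi> s \<ge> c * (1 - s)" "\<phi> s > 0" "\<phi> s \<le> 1 - s" if "s \<in> I01" for s
  proof -
    show "\<phi> s \<ge> c * (1 - s)" using phi_lower[OF mu, of s] that by (simp add: c_def \<phi>_def)
    moreover have "c * (1 - s) > 0" using c that by simp
    ultimately show "\<phi> s > 0" by linarith
    show "\<phi> s \<le> 1 - s" using phi_bounds[OF mu, of s] that by (simp add: \<phi>_def)
  qed
  have c\<phi>: "continuous_on I01 \<phi>" unfolding \<phi>_def
    by (rule continuous_on_subset[OF continuous_on_phi[OF mu]]) auto
  have cX: "continuous_on I01 X" unfolding X_def by (rule continuous_on_subset[OF cont]) auto
  have cW: "continuous_on I01 W" unfolding W_def X_def[symmetric] \<phi>_def[symmetric]
    using low(2) by (intro continuous_intros c\<phi> cX) force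
  obtain B where B: "\<And>s. s \<in> {0..1} \<Longrightarrow> \<bar>X s\<bar> \<le> B"
  proof -
    have "bounded (X ` {0..1})" unfolding X_def by (intro compact_imp_bounded compact_continuous_image cont) simp
    then obtain B where "\<forall>x\<in>{0..1}. \<bar>X x\<bar> \<le> B" unfolding bounded_iff by auto
    then show thesis by (intro that[of B]) blast
  qed
  let ?e = "energy_density \<mu>"
  have ie: "set_integrable lborel I01 ?e"
    by (rule crisanti_sommers_real(1)[OF mu _ fin]) (use low in \<open>simp add: \<phi>_def\<close>)
  have \<psi>0: "0 \<le> \<psi> s" if "s \<in> I01" for s using low(3)[OF that] by (simp add: \<psi>_def)
  have \<psi>e: "\<psi> s / (1 - s)\<^sup>2 \<le> ?e s" if "s \<in> I01" for s
  proof -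
    have "?e s = \<psi> s / (\<phi> s * (1 - s))"
      using low(2)[OF that] that by (simp add: energy_density_def \<phi>_def[symmetric] \<psi>_def divide_simps)
    moreover have "\<psi> s / ((1 - s) * (1 - s)) \<le> \<psi> s / (\<phi> s * (1 - s))"
      using low[OF that] that \<psi>0[OF that] by (intro divide_left_mono mult_right_mono mult_pos_pos) auto
    ultimately show ?thesis by (simp add: power2_eq_square)
  qed
  have c\<psi>: "continuous_on I01 \<psi>" unfolding \<psi>_def by (intro continuous_intros c\<phi>)
  have i\<psi>: "set_integrable lborel I01 (\<lambda>s. \<psi> s / (1 - s)\<^sup>2)"
    by (rule set_integrable_I01_dominated[OF ie]) (use \<psi>e \<psi>0 in \<open>auto intro!: continuous_intros c\<psi>\<close>)
  have Wb: "\<bar>W s\<bar> \<le> 1 / c\<^sup>2 / (1 - s)\<^sup>2 + B" if "s \<in> I01" for s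
  proof -
    have "(c * (1 - s))\<^sup>2 \<le> (\<phi> s)\<^sup>2" using low[OF that] c that by (intro power_mono) auto
    moreover have "(c * (1 - s))\<^sup>2 > 0" using c that by simp
    ultimately have "1 / (\<phi> s)\<^sup>2 \<le> 1 / (c * (1 - s))\<^sup>2" by (intro frac_le) auto
    moreover have "0 \<le> 1 / (\<phi> s)\<^sup>2" by simp
    ultimately have "\<bar>1 / (\<phi> s)\<^sup>2\<bar> \<le> 1 / c\<^sup>2 / (1 - s)\<^sup>2" by (simp add: power_mult_distrib)
    moreover have "\<bar>X s\<bar> \<le> B" using B that by auto
    ultimately show ?thesis unfolding W_def X_def[symmetric] \<phi>_def[symmetric] by linarith
  qed
  have B0: "B \<ge> 0" using B[of 0] by auto
  have iW\<psi>: "set_integrable lborel I01 (\<lambda>s. \<bar>W s\<bar> * \<psi> s)"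
  proof (rule set_integrable_I01_dominated)
    show "set_integrable lborel I01 (\<lambda>s. 1 / c\<^sup>2 * (\<psi> s / (1 - s)\<^sup>2) + B * \<psi> s)"
      using c by (intro set_integral_add(1) set_integrable_mult_right i\<psi>
           set_integrable_I01_bounded[OF c\<psi>, of 1]) (use \<psi>0 low(2) in \<open>force simp: \<psi>_def\<close>)
    show "\<bar>\<bar>W s\<bar> * \<psi> s\<bar> \<le> 1 / c\<^sup>2 * (\<psi> s / (1 - s)\<^sup>2) + B * \<psi> s" if "s \<in> I01" for s
      using mult_right_mono[OF Wb[OF that] \<psi>0[OF that]] \<psi>0[OF that]
      by (simp add: abs_mult distrib_right)
  qed (intro continuous_intros cW c\<psi>)
  have iW\<psi>': "set_integrable lborel I01 (\<lambda>s. W s * \<psi> s)"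
    by (rule set_integrable_I01_dominated[OF iW\<psi>]) (use \<psi>0 in \<open>auto intro!: continuous_intros cW c\<psi> simp: abs_mult\<close>)
  define k where "k = (LINT s:I01|lborel. W s * \<psi> s) - h\<^sup>2 * (1 - c)"
  have "k \<le> K x" if x: "x \<in> I01" for x
  proof -
    define p where "p = (\<lambda>s. 1 - max x s)"
    define w where "w = (\<lambda>s. max 0 (x - s))"
    define d where "d = (\<lambda>s. \<phi> s - p s)"
    define J where "J = (\<lambda>s. (\<psi> s + w s) / (1 - s)\<^sup>2)"
    define G where "G = (\<lambda>s. d s / (\<phi> s)\<^sup>2)"
    have dw: "d s = w s - \<psi> s" for s by (simp add: d_def p_def w_def \<psi>_def max_def)
    have w0: "0 \<le> w s" for s by (simp add: w_def)
    have pb: "0 \<le> p s" "p s \<le> 1 - s" if "s \<in> I01" for s using that x by (auto simp: p_def)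
    have cp: "continuous_on I01 p" "continuous_on I01 w"
      unfolding p_def w_def by (intro continuous_intros)+
    have cd: "continuous_on I01 d" unfolding d_def by (intro continuous_intros c\<phi> cp)
    have iw: "set_integrable lborel I01 (\<lambda>s. w s / (1 - s)\<^sup>2)"
    proof (rule set_integrable_I01_bounded[where B = "1 / (1 - x)\<^sup>2"])
      show "\<bar>w s / (1 - s)\<^sup>2\<bar> \<le> 1 / (1 - x)\<^sup>2" if "s \<in> I01" for s
      proof (cases "s \<le> x")
        case True
        have "(1 - x)\<^sup>2 \<le> (1 - s)\<^sup>2" using True x by (intro power_mono) auto
        moreover have "(1 - x)\<^sup>2 > 0" using x by simp
        ultimately have "w s / (1 - s)\<^sup>2 \<le> 1 / (1 - x)\<^sup>2"
          using True x that by (intro frac_le) (auto simp: w_def)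
        then show ?thesis using w0[of s] by simp
      qed (simp add: w_def)
    qed (auto intro!: continuous_intros cp)
    have iJ: "set_integrable lborel I01 J"
      unfolding J_def add_divide_distrib by (rule set_integral_add(1)[OF i\<psi> iw])
    have dJ: "\<bar>d s\<bar> \<le> J s * (1 - s)\<^sup>2" if "s \<in> I01" for s
      using \<psi>0[OF that] w0[of s] that by (simp add: dw J_def)
    have J0: "0 \<le> J s" if "s \<in> I01" for s using \<psi>0[OF that] w0[of s] by (simp add: J_def)
    have d1: "\<bar>d s\<bar> \<le> 1 - s" if "s \<in> I01" for s
      using pb[OF that] low[OF that] by (simp add: d_def)
    have GJ: "\<bar>G s\<bar> \<le> 1 / c\<^sup>2 * J s" if "s \<in> I01" for s
    proof -
      have "(c * (1 - s))\<^sup>2 \<le> (\<phi> s)\<^sup>2" using low[OF that] c that by (intro power_mono) auto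
      moreover have "(c * (1 - s))\<^sup>2 > 0" using c that by simp
      ultimately have "\<bar>d s\<bar> / (\<phi> s)\<^sup>2 \<le> (J s * (1 - s)\<^sup>2) / (c * (1 - s))\<^sup>2"
        using dJ[OF that] J0[OF that] by (intro frac_le) auto
      then show ?thesis using that by (simp add: G_def power_mult_distrib)
    qed
    have iG: "set_integrable lborel I01 G"
    proof (rule set_integrable_I01_dominated[OF _ _ GJ])
      show "set_integrable lborel I01 (\<lambda>s. 1 / c\<^sup>2 * J s)" by (intro set_integrable_mult_right iJ)
      show "continuous_on I01 G" unfolding G_def using low(2) by (intro continuous_intros cd c\<phi>) force
    qed
    have iXp: "set_integrable lborel I01 (\<lambda>s. X s * (p s - \<phi> s))"
    proof (rule set_integrable_I01_bounded[where B = B])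
      show "\<bar>X s * (p s - \<phi> s)\<bar> \<le> B" if "s \<in> I01" for s
        using mult_mono[of "\<bar>X s\<bar>" B "\<bar>p s - \<phi> s\<bar>" 1] B[of s] d1[OF that] that B0
        by (simp add: abs_mult d_def abs_minus_commute)
    qed (intro continuous_intros cX cp c\<phi>)
    have iX\<phi>: "set_integrable lborel I01 (\<lambda>s. X s * \<phi> s)"
    proof (rule set_integrable_I01_bounded[where B = B])
      show "\<bar>X s * \<phi> s\<bar> \<le> B" if "s \<in> I01" for s
        using mult_mono[of "\<bar>X s\<bar>" B "\<bar>\<phi> s\<bar>" 1] B[of s] low[OF that] that B0
        by (simp add: abs_mult)
    qed (intro continuous_intros cX c\<phi>)
    define A where "A = (LINT s:I01|lborel. X s * (p s - \<phi> s)) + (LINT s:I01|lborel. G s) + h\<^sup>2 * (p 0 - \<phi> 0)"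
    define b where "b = (LINT s:I01|lborel. 2 / c ^ 3 * J s)"
    \<comment> \<open>The restriction \<open>e \<le> 1/2\<close> ensures \<open>phi \<nu> \<ge> \<phi> / 2\<close>, which bounds the remainder independently of \<open>e\<close>.\<close>
    have key: "0 \<le> A + e * b" if e: "0 < e" "e \<le> 1/2" for e
    proof -
      obtain \<nu> where nu: "\<nu> \<in> Pr01" "\<And>t. t \<in> {0..1} \<Longrightarrow> phi \<nu> t = (1 - e) * \<phi> t + e * p t"
        using exists_mixture_with_dirac[OF mu, of x e] x e by (auto simp: \<phi>_def p_def)
      have half: "phi \<nu> s \<ge> \<phi> s / 2" if s: "s \<in> I01" for s
      proof -
        have "(1 - e) * \<phi> s \<ge> 1/2 * \<phi> s" using e low(2)[OF s] by (intro mult_right_mono) auto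
        moreover have "e * p s \<ge> 0" using e pb[OF s] by simp
        ultimately show ?thesis using nu(2)[of s] s by simp
      qed
      have \<nu>0: "phi \<nu> s > 0" if s: "s \<in> I01" for s using half[OF s] low(2)[OF s] by linarith
      define r where "r = (\<lambda>s. (d s)\<^sup>2 / ((\<phi> s)\<^sup>2 * phi \<nu> s))"
      have en: "energy_density \<nu> s = ?e s + e * G s + e\<^sup>2 * r s" if s: "s \<in> I01" for s
      proof -
        have f: "phi \<nu> s = \<phi> s - e * d s" using nu(2)[of s] s by (simp add: d_def algebra_simps)
        have nz: "\<phi> s \<noteq> 0" "\<phi> s - e * d s \<noteq> 0" using low(2)[OF s] \<nu>0[OF s] f by auto
        have "1 / (\<phi> s - e * d s) = 1 / \<phi> s + e * (d s / (\<phi> s)\<^sup>2) + e\<^sup>2 * ((d s)\<^sup>2 / ((\<phi> s)\<^sup>2 * (\<phi> s - e * d s)))"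
          using nz by (simp add: divide_simps) (simp add: algebra_simps power2_eq_square)
        then show ?thesis by (simp add: energy_density_def G_def r_def f \<phi>_def[symmetric])
      qed
      have r0: "0 \<le> r s" if s: "s \<in> I01" for s using \<nu>0[OF s] by (simp add: r_def)
      have rb: "r s \<le> 2 / c ^ 3 * J s" if s: "s \<in> I01" for s
      proof -
        have n: "(d s)\<^sup>2 \<le> (1 - s) * (J s * (1 - s)\<^sup>2)"
          using mult_mono[OF d1[OF s] dJ[OF s]] s by (simp add: power2_eq_square)
        have "(c * (1 - s))\<^sup>2 * (c * (1 - s) / 2) \<le> (\<phi> s)\<^sup>2 * phi \<nu> s"
          using low[OF s] c s half[OF s] by (intro mult_mono power_mono) auto
        moreover have "(c * (1 - s))\<^sup>2 * (c * (1 - s) / 2) > 0" using c s by simp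
        ultimately have "r s \<le> ((1 - s) * (J s * (1 - s)\<^sup>2)) / ((c * (1 - s))\<^sup>2 * (c * (1 - s) / 2))"
          unfolding r_def using n J0[OF s] s by (intro frac_le) auto
        also have "\<dots> = 2 / c ^ 3 * J s" using c s by (simp add: divide_simps power2_eq_square power3_eq_cube)
        finally show ?thesis .
      qed
      have cr: "continuous_on I01 r"
      proof -
        have "continuous_on I01 (phi \<nu>)" by (rule continuous_on_subset[OF continuous_on_phi[OF nu(1)]]) auto
        then show ?thesis unfolding r_def using low(2) \<nu>0 by (intro continuous_intros cd c\<phi>) force+
      qed
      have iJ2: "set_integrable lborel I01 (\<lambda>s. 2 / c ^ 3 * J s)" by (intro set_integrable_mult_right iJ)
      have ir: "set_integrable lborel I01 r"
        by (rule set_integrable_I01_dominated[OF iJ2 cr]) (use r0 rb in auto)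
      have i3: "set_integrable lborel I01 (\<lambda>s. ?e s + e * G s + e\<^sup>2 * r s)"
        by (intro set_integral_add(1) set_integrable_mult_right ie iG ir)
      have i\<nu>: "set_integrable lborel I01 (energy_density \<nu>)"
        using i3 by (subst set_integrable_cong[OF refl refl en]) auto
      have E\<nu>: "(LINT s:I01|lborel. energy_density \<nu> s)
          = (LINT s:I01|lborel. ?e s) + e * (LINT s:I01|lborel. G s) + e\<^sup>2 * (LINT s:I01|lborel. r s)"
      proof -
        have "(LINT s:I01|lborel. energy_density \<nu> s) = (LINT s:I01|lborel. ?e s + e * G s + e\<^sup>2 * r s)"
          by (intro set_lebesgue_integral_cong) (auto simp: en)
        also have "\<dots> = (LINT s:I01|lborel. ?e s) + e * (LINT s:I01|lborel. G s) + e\<^sup>2 * (LINT s:I01|lborel. r s)"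
          using ie iG ir by (simp add: set_integral_add)
        finally show ?thesis .
      qed
      have X\<nu>: "(LINT s:I01|lborel. X s * phi \<nu> s)
          = (LINT s:I01|lborel. X s * \<phi> s) + e * (LINT s:I01|lborel. X s * (p s - \<phi> s))"
      proof -
        have "(LINT s:I01|lborel. X s * phi \<nu> s) = (LINT s:I01|lborel. X s * \<phi> s + e * (X s * (p s - \<phi> s)))"
          by (intro set_lebesgue_integral_cong) (auto simp: nu(2) algebra_simps)
        also have "\<dots> = (LINT s:I01|lborel. X s * \<phi> s) + e * (LINT s:I01|lborel. X s * (p s - \<phi> s))"
          using iXp iX\<phi> by (simp add: set_integral_add)
        finally show ?thesis .
      qed
      have rl: "(LINT s:I01|lborel. r s) \<le> b"
        unfolding b_def by (intro set_integral_mono ir iJ2 rb)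
      have \<mu>p: "\<And>s. s \<in> I01 \<Longrightarrow> phi \<mu> s > 0" using low(2) by (simp add: \<phi>_def)
      have "(LINT s:I01|lborel. X s * \<phi> s) + (LINT s:I01|lborel. ?e s) + h\<^sup>2 * \<phi> 0
          \<le> (LINT s:I01|lborel. X s * phi \<nu> s) + (LINT s:I01|lborel. energy_density \<nu> s) + h\<^sup>2 * phi \<nu> 0"
        using min[OF nu(1)] crisanti_sommers_real(2)[where \<mu> = \<mu> and \<xi> = \<xi> and h = h, OF mu _ ie] \<mu>p
          crisanti_sommers_real(2)[where \<mu> = \<nu> and \<xi> = \<xi> and h = h, OF nu(1) _ i\<nu>] \<nu>0
        by (simp add: X_def \<phi>_def)
      also have "\<dots> = (LINT s:I01|lborel. X s * \<phi> s) + (LINT s:I01|lborel. ?e s) + h\<^sup>2 * \<phi> 0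
           + e * A + e\<^sup>2 * (LINT s:I01|lborel. r s)"
      proof -
        have n0: "phi \<nu> 0 = \<phi> 0 + e * (p 0 - \<phi> 0)" using nu(2)[of 0] by (simp add: algebra_simps)
        show ?thesis unfolding X\<nu> E\<nu> A_def n0 by (simp add: algebra_simps)
      qed
      finally have "0 \<le> e * A + e\<^sup>2 * (LINT s:I01|lborel. r s)" by simp
      also have "\<dots> \<le> e * A + e\<^sup>2 * b" using rl by (intro add_left_mono mult_left_mono) auto
      also have "\<dots> = e * (A + e * b)" by (simp add: algebra_simps power2_eq_square)
      finally show ?thesis using e(1) by (simp add: zero_le_mult_iff)
    qed
    have A0: "A \<ge> 0"
    proof (rule tendsto_lowerbound)
      show "((\<lambda>e. A + e * b) \<longlongrightarrow> A) (at_right 0)" by (auto intro!: tendsto_eq_intros)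
      show "\<forall>\<^sub>F e in at_right 0. 0 \<le> A + e * b"
        using eventually_at_right_real[of 0 "1/2"] by (rule eventually_mono) (use key in auto)
    qed simp
    have pt: "W s * w s = X s * (p s - \<phi> s) + G s + W s * \<psi> s" for s
    proof -
      have "W s * w s - W s * \<psi> s = W s * d s" by (simp add: dw algebra_simps)
      also have "\<dots> = X s * (p s - \<phi> s) + G s"
        by (simp add: W_def G_def X_def \<phi>_def[symmetric] d_def algebra_simps diff_divide_distrib)
      finally show ?thesis by simp
    qed
    have iWw: "set_integrable lborel I01 (\<lambda>s. W s * w s)"
      unfolding pt by (intro set_integral_add(1) iG iXp iW\<psi>')
    have "A = (LINT s:I01|lborel. W s * w s - W s * \<psi> s) - h\<^sup>2 * (x - (1 - c))"
    proof -
      have "(LINT s:I01|lborel. X s * (p s - \<phi> s)) + (LINT s:I01|lborel. G s)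
          = (LINT s:I01|lborel. X s * (p s - \<phi> s) + G s)" using iXp iG by (simp add: set_integral_add)
      also have "\<dots> = (LINT s:I01|lborel. W s * w s - W s * \<psi> s)"
        by (simp add: pt)
      finally show ?thesis using x unfolding A_def by (simp add: p_def c_def algebra_simps)
    qed
    also have "\<dots> = K x - k"
      using iWw iW\<psi>' by (simp add: K_def k_def w_def set_integral_diff algebra_simps)
    finally show ?thesis using A0 by simp
  qed
  moreover have "AE x in embed \<mu>. x \<in> I01 \<and> K x = k"
  proof -
    have no1: "measure (embed \<mu>) {1} = 0"
    proof (rule ccontr)
      let ?m = "measure (embed \<mu>) {1}"
      assume "?m \<noteq> 0"
      then have m: "?m > 0" by (simp add: zero_less_measure_iff)
      have le: "measure (embed \<mu>) {..<1} + ?m \<le> 1"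
      proof -
        have "measure (embed \<mu>) ({..<1} \<union> {1}) = measure (embed \<mu>) {..<1} + ?m"
          by (rule M.finite_measure_Union) auto
        then show ?thesis using M.prob_le_1 by metis
      qed
      have u: "\<phi> s \<le> (1 - ?m) * (1 - s)" if "s \<in> I01" for s
      proof -
        have "\<phi> s \<le> measure (embed \<mu>) {..<1} * (1 - s)"
          using phi_diff_bounds(2)[OF mu, of s 1] phi_1[OF mu] that by (simp add: \<phi>_def)
        also have "\<dots> \<le> (1 - ?m) * (1 - s)"
          using that le by (intro mult_right_mono) auto
        finally show ?thesis .
      qed
      have "set_integrable lborel I01 (\<lambda>s. ?m / (1 - s))"
      proof (rule set_integrable_I01_dominated[OF i\<psi>])
        show "\<bar>?m / (1 - s)\<bar> \<le> \<psi> s / (1 - s)\<^sup>2" if "s \<in> I01" for s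
        proof -
          have "?m * (1 - s) \<le> \<psi> s" using u[OF that] by (simp add: \<psi>_def algebra_simps)
          then have "?m * (1 - s) / (1 - s)\<^sup>2 \<le> \<psi> s / (1 - s)\<^sup>2" by (rule divide_right_mono) simp
          then show ?thesis using that m by (simp add: power2_eq_square)
        qed
      qed (auto intro!: continuous_intros)
      then show False using not_set_integrable_inverse[OF m] by blast
    qed
    have ae: "AE x in embed \<mu>. x \<in> I01"
    proof -
      have "emeasure (embed \<mu>) {1} = 0" using no1 by (simp add: M.emeasure_eq_measure)
      then have "AE x in embed \<mu>. x \<noteq> 1" by (intro AE_I[of _ _ "{1}"]) auto
      then show ?thesis using embed_facts(4)[OF mu] by eventually_elim auto
    qed
    \<comment> \<open>The average of \<open>K\<close> is \<open>k\<close>, because the average of \<open>max 0 (x - s)\<close> over \<open>x\<close> is \<open>\<psi> s\<close>.\<close>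
    interpret P: pair_sigma_finite lborel "embed \<mu>" ..
    define f where "f = (\<lambda>s x. indicator I01 s *\<^sub>R (W s * max 0 (x - s)))"
    have mf: "(\<lambda>(s, x). f s x) \<in> borel_measurable (lborel \<Otimes>\<^sub>M embed \<mu>)"
    proof -
      have "(\<lambda>s. indicator I01 s * W s) \<in> borel_measurable lborel"
        using set_borel_measurable_I01[OF cW] by (simp add: set_borel_measurable_def)
      then have "(\<lambda>z. (\<lambda>s. indicator I01 s * W s) (fst z) * max 0 (snd z - fst z)) \<in> borel_measurable (lborel \<Otimes>\<^sub>M embed \<mu>)"
        by measurable
      then show ?thesis by (simp add: f_def split_beta' mult.assoc)
    qed
    have imax: "integrable (embed \<mu>) (\<lambda>x. max 0 (x - s))"
        and emax: "(\<integral>x. max 0 (x - s) \<partial>embed \<mu>) = \<psi> s" if "s \<in> I01" for s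
    proof -
      have e: "max 0 (x - s) = (1 - s) - (1 - max x s)" for x by (simp add: max_def)
      have i: "integrable (embed \<mu>) (\<lambda>x. 1 - max x s)" using that by (intro integrable_one_minus_max[OF mu]) auto
      show "integrable (embed \<mu>) (\<lambda>x. max 0 (x - s))" unfolding e by (rule Bochner_Integration.integrable_diff[OF _ i]) simp
      show "(\<integral>x. max 0 (x - s) \<partial>embed \<mu>) = \<psi> s"
        unfolding e using that phi_eq_expectation[OF mu, of s] M.prob_space
        by (subst Bochner_Integration.integral_diff[OF _ i]) (auto simp: \<psi>_def \<phi>_def)
    qed
    have If: "integrable (lborel \<Otimes>\<^sub>M embed \<mu>) (case_prod f)"
    proof (rule P.Fubini_integrable)
      show "case_prod f \<in> borel_measurable (lborel \<Otimes>\<^sub>M embed \<mu>)" using mf by simp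
      have "(\<integral>x. norm (case (s, x) of (s, x) \<Rightarrow> f s x) \<partial>embed \<mu>) = indicator I01 s *\<^sub>R (\<bar>W s\<bar> * \<psi> s)" for s
      proof (cases "s \<in> I01")
        case True
        then have "(\<integral>x. norm (case (s, x) of (s, x) \<Rightarrow> f s x) \<partial>embed \<mu>) = (\<integral>x. \<bar>W s\<bar> * max 0 (x - s) \<partial>embed \<mu>)"
          by (simp add: f_def abs_mult)
        then show ?thesis using emax[OF True] True by simp
      qed (simp add: f_def)
      then show "integrable lborel (\<lambda>s. \<integral>x. norm (case (s, x) of (s, x) \<Rightarrow> f s x) \<partial>embed \<mu>)"
        using iW\<psi> by (simp add: set_integrable_def)
      have "integrable (embed \<mu>) (\<lambda>x. f s x)" for s
        using imax[of s] by (cases "s \<in> I01") (auto simp: f_def)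
      then show "AE s in lborel. integrable (embed \<mu>) (\<lambda>x. case (s, x) of (s, x) \<Rightarrow> f s x)" by simp
    qed
    have KI: "(\<lambda>x. K x) = (\<lambda>x. (\<integral>s. f s x \<partial>lborel) - h\<^sup>2 * x)"
      by (simp add: K_def f_def set_lebesgue_integral_def)
    have ix: "integrable (embed \<mu>) (\<lambda>x. x)"
      by (rule M.integrable_const_bound[where B = 1]) (auto intro!: eventually_mono[OF ae])
    have Ex: "(\<integral>x. x \<partial>embed \<mu>) = 1 - c"
    proof -
      have "(\<integral>x. x \<partial>embed \<mu>) = (\<integral>x. max 0 (x - 0) \<partial>embed \<mu>)"
        by (rule integral_cong_AE) (auto intro!: eventually_mono[OF ae])
      then show ?thesis using emax[of 0] by (simp add: \<psi>_def c_def)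
    qed
    have iK: "integrable (embed \<mu>) K" unfolding KI
      by (intro Bochner_Integration.integrable_diff P.integrable_snd If integrable_mult_right ix)
    have "(\<integral>x. K x \<partial>embed \<mu>) = (\<integral>x. (\<integral>s. f s x \<partial>lborel) \<partial>embed \<mu>) - h\<^sup>2 * (1 - c)"
      unfolding KI using P.integrable_snd[OF If] ix Ex by simp
    also have "(\<integral>x. (\<integral>s. f s x \<partial>lborel) \<partial>embed \<mu>) = (\<integral>s. (\<integral>x. f s x \<partial>embed \<mu>) \<partial>lborel)"
      by (rule P.Fubini_integral[OF If])
    also have "\<dots> = (LINT s:I01|lborel. W s * \<psi> s)"
      unfolding set_lebesgue_integral_def
    proof (rule Bochner_Integration.integral_cong[OF refl])
      fix s
      show "(\<integral>x. f s x \<partial>embed \<mu>) = indicator I01 s *\<^sub>R (W s * \<psi> s)"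
        using emax[of s] by (cases "s \<in> I01") (auto simp: f_def)
    qed
    finally have "(\<integral>x. K x - k \<partial>embed \<mu>) = 0"
      using iK M.prob_space by (simp add: k_def)
    moreover have "AE x in embed \<mu>. 0 \<le> K x - k"
      using ae by eventually_elim (use \<open>\<And>x. x \<in> I01 \<Longrightarrow> k \<le> K x\<close> in auto)
    moreover have "integrable (embed \<mu>) (\<lambda>x. K x - k)" using iK by simp
    ultimately have "AE x in embed \<mu>. K x - k = 0"
      using integral_nonneg_eq_0_iff_AE by blast
    then show ?thesis using ae by eventually_elim auto
  qed
  ultimately show ?thesis by blast
qed

section \<open>The contact set\<close>

text \<open>
  The kernel \<open>max 0 (x - s)\<close> is the fundamental solution of the second derivative: \<open>K\<close> is a second
  primitive of \<open>W\<close>, with slope \<open>- a\<close> at \<open>0\<close>.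
\<close>

lemma double_primitive:
  fixes W :: "real \<Rightarrow> real" and a :: real
  assumes cW: "continuous_on I01 W"
  defines "K \<equiv> (\<lambda>x. (LINT s:I01|lborel. W s * max 0 (x - s)) - a * x)"
  defines "V \<equiv> (\<lambda>x. integral {0..x} W - a)"
  shows "\<And>x. x \<in> I01 \<Longrightarrow> (K has_real_derivative V x) (at x within I01)"
    and "\<And>x. x \<in> I01 \<Longrightarrow> (V has_real_derivative W x) (at x within I01)"
    and "V 0 = - a"
proof -
  have sub: "continuous_on {0..x} W" if "x < 1" for x
    by (rule continuous_on_subset[OF cW]) (use that in auto)
  have cs: "continuous_on {0..x} (\<lambda>s. s * W s)" if "x < 1" for x
    by (intro continuous_intros sub that)
  have Keq: "K x = x * integral {0..x} W - integral {0..x} (\<lambda>s. s * W s) - a * x" if x: "x \<in> I01" for x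
  proof -
    have "(LINT s:I01|lborel. W s * max 0 (x - s)) = (LINT s:{0..x}|lborel. x * W s - s * W s)"
      unfolding set_lebesgue_integral_def using x
      by (intro Bochner_Integration.integral_cong) (auto simp: algebra_simps split: split_indicator)
    also have "\<dots> = integral {0..x} (\<lambda>s. x * W s - s * W s)"
      using x by (intro set_borel_integral_eq_integral(2) borel_integrable_atLeastAtMost' continuous_intros sub cs) auto
    also have "\<dots> = x * integral {0..x} W - integral {0..x} (\<lambda>s. s * W s)"
      using x by (subst integral_diff) (auto intro!: integrable_continuous_interval continuous_intros sub cs)
    finally show ?thesis by (simp add: K_def)
  qed
  have at: "at x within I01 = at x within {0..(x+1)/2}" if "x \<in> I01" for x :: real
    using that by (intro at_within_nhd[where S = "{..<(x+1)/2}"]) auto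
  have D: "((\<lambda>x. integral {0..x} g) has_real_derivative g x) (at x within I01)"
    if x: "x \<in> I01" and g: "\<And>y. y < 1 \<Longrightarrow> continuous_on {0..y} g" for x and g :: "real \<Rightarrow> real"
    unfolding at[OF x] using x by (intro integral_has_real_derivative g) auto
  show "(V has_real_derivative W x) (at x within I01)" if "x \<in> I01" for x
    unfolding V_def using D[OF that sub] by (auto intro!: derivative_eq_intros)
  show "(K has_real_derivative V x) (at x within I01)" if x: "x \<in> I01" for x
  proof (rule has_field_derivative_transform_within[OF _ zero_less_one x])
    show "((\<lambda>x. x * integral {0..x} W - integral {0..x} (\<lambda>s. s * W s) - a * x) has_real_derivative V x) (at x within I01)"
      using D[OF x sub] D[OF x cs] by (auto intro!: derivative_eq_intros simp: V_def)
  qed (simp add: Keq)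
  show "V 0 = - a" by (simp add: V_def)
qed

lemma mean_value_within:
  fixes f f' :: "real \<Rightarrow> real"
  assumes d: "\<And>x. x \<in> I01 \<Longrightarrow> (f has_real_derivative f' x) (at x within I01)"
    and ab: "a < b" "0 \<le> a" "b < 1"
  obtains z where "a < z" "z < b" "f b - f a = f' z * (b - a)"
proof (rule mvt[OF ab(1), of f "\<lambda>x y. f' x * y"])
  show "continuous_on {a..b} f"
    by (rule continuous_on_subset[OF DERIV_continuous_on[OF d]]) (use ab in auto)
  show "(f has_derivative (*) (f' x)) (at x)" if "a < x" "x < b" for x
    using d[of x] that ab at_within_interior[of x I01]
    by (simp add: has_field_derivative_def interior_atLeastLessThan)
qed (use that in blast)

text \<open>
  A function \<open>K\<close> on \<open>[0,1)\<close> with slope \<open>V\<close> and curvature \<open>W\<close>, bounded below by \<open>k\<close>. Derivatives are taken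
  within \<open>[0,1)\<close>, so they are one-sided at \<open>0\<close>, where a minimum would only give \<open>V 0 \<ge> 0\<close>;
  the assumption \<open>V 0 \<le> 0\<close> lets \<open>0\<close> behave like an interior minimum.
\<close>

locale contact_set =
  fixes K V W :: "real \<Rightarrow> real" and k :: real
  assumes dK: "\<And>x. x \<in> I01 \<Longrightarrow> (K has_real_derivative V x) (at x within I01)"
    and dV: "\<And>x. x \<in> I01 \<Longrightarrow> (V has_real_derivative W x) (at x within I01)"
    and V0: "V 0 \<le> 0"
    and cW: "continuous_on I01 W"
    and kmin: "\<And>x. x \<in> I01 \<Longrightarrow> k \<le> K x"
begin

definition contact :: "real set" where "contact = {x\<in>I01. K x = k}"

lemma contact_subset: "x \<in> contact \<Longrightarrow> 0 \<le> x \<and> x < 1" by (simp add: contact_def)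

text \<open>
  At a contact point the slope is at most \<open>0\<close>, so negative curvature would make \<open>K\<close> drop below its minimum
  immediately to the right.
\<close>

lemma curvature_nonneg_on_contact:
  assumes x: "x \<in> contact" shows "W x \<ge> 0"
proof (rule ccontr)
  assume "\<not> W x \<ge> 0"
  then have W: "W x < 0" by simp
  have xI: "x \<in> I01" "K x = k" using x by (auto simp: contact_def)
  have "(W \<longlongrightarrow> W x) (at x within I01)" using cW xI by (simp add: continuous_on_def)
  then have "eventually (\<lambda>y. W y < 0) (at x within I01)" using W by (rule order_tendstoD)
  then obtain e where e: "e > 0" "\<And>y. y \<in> I01 \<Longrightarrow> y \<noteq> x \<Longrightarrow> dist y x < e \<Longrightarrow> W y < 0"
    unfolding eventually_at by blast
  define y where "y = min (x + e/2) ((x + 1)/2)"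
  have y: "x < y" "y < 1" "y < x + e" using e(1) xI by (auto simp: y_def min_def)
  have Vx: "V x \<le> 0"
  proof (cases "x = 0")
    case False
    then have i: "0 < x" "x < 1" using xI by auto
    then have "(K has_real_derivative V x) (at x)"
      using dK[OF xI(1)] at_within_interior[of x I01] by (simp add: interior_atLeastLessThan)
    moreover have "\<forall>y. \<bar>x - y\<bar> < min x (1 - x) \<longrightarrow> K x \<le> K y"
      using kmin xI(2) by (auto simp: abs_if split: if_splits)
    ultimately have "V x = 0" using i by (intro DERIV_local_min[where d = "min x (1 - x)"]) auto
    then show ?thesis by simp
  qed (use V0 in simp)
  obtain z where z: "x < z" "z < y" "K y - K x = V z * (y - x)"
    using mean_value_within[OF dK y(1)] xI y by auto
  obtain w where w: "x < w" "w < z" "V z - V x = W w * (z - x)"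
    using mean_value_within[OF dV z(1)] xI y z by auto
  have "W w < 0" using w z y xI by (intro e(2)) (auto simp: dist_real_def)
  then have "V z < 0" using w z Vx by (smt (verit) mult_neg_pos)
  then have "K y < K x" using z by (smt (verit) mult_neg_pos)
  then show False using kmin[of y] xI y by auto
qed

text \<open>
  By convexity \<open>K\<close> does not exceed its value \<open>k\<close> at the two ends. Written out with mean values: a value above \<open>k\<close>
  would be preceded by a positive slope and followed by a negative one.
\<close>

lemma contact_between:
  assumes uv: "u \<in> contact" "v \<in> contact" "u < v" and W: "\<And>x. u < x \<Longrightarrow> x < v \<Longrightarrow> W x \<ge> 0"
  shows "{u..v} \<subseteq> contact" and "\<And>x. u < x \<Longrightarrow> x < v \<Longrightarrow> W x = 0"
proof -
  note I = contact_subset[OF uv(1)] contact_subset[OF uv(2)]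
  have Keq: "K x = k" if x: "u < x" "x < v" for x
  proof (rule ccontr)
    assume "K x \<noteq> k"
    then have Kx: "K x > k" using kmin[of x] x I by force
    obtain z1 where z1: "u < z1" "z1 < x" "K x - K u = V z1 * (x - u)"
      using mean_value_within[OF dK x(1)] I x by auto
    obtain z2 where z2: "x < z2" "z2 < v" "K v - K x = V z2 * (v - x)"
      using mean_value_within[OF dK x(2)] I x by auto
    have V1: "V z1 > 0" using z1 Kx uv(1) x unfolding contact_def
      by (smt (verit) mem_Collect_eq mult_nonpos_nonneg)
    have V2: "V z2 < 0" using z2 Kx uv(2) x unfolding contact_def
      by (smt (verit) mem_Collect_eq mult_nonneg_nonneg)
    have l: "z1 < z2" using z1 z2 by simp
    obtain w where w: "z1 < w" "w < z2" "V z2 - V z1 = W w * (z2 - z1)"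
      using mean_value_within[OF dV l] I z1 z2 by auto
    have "W w \<ge> 0" using w z1 z2 by (intro W) auto
    then show False using w l V1 V2 by (smt (verit) mult_nonneg_nonneg)
  qed
  show "{u..v} \<subseteq> contact"
  proof
    fix x assume "x \<in> {u..v}"
    then consider "x = u" | "x = v" | "u < x" "x < v" by fastforce
    then show "x \<in> contact" by cases (use uv Keq I in \<open>auto simp: contact_def\<close>)
  qed
  have d: "(f has_real_derivative f' x) (at x)"
    if "\<And>x. x \<in> I01 \<Longrightarrow> (f has_real_derivative f' x) (at x within I01)" "u < x" "x < v" for f f' x
    using that(1)[of x] that(2,3) I at_within_interior[of x I01] by (simp add: interior_atLeastLessThan)
  have op: "open {u<..<v}" by simp
  have V0: "V x = 0" if x: "u < x" "x < v" for x
  proof -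
    have "((\<lambda>_. k) has_real_derivative V x) (at x)"
      by (rule has_field_derivative_transform_within_open[OF d[OF dK x] op]) (use x Keq in auto)
    then show ?thesis using DERIV_unique DERIV_const by blast
  qed
  show "W x = 0" if x: "u < x" "x < v" for x
  proof -
    have "((\<lambda>_. 0) has_real_derivative W x) (at x)"
      by (rule has_field_derivative_transform_within_open[OF d[OF dV x] op]) (use x V0 in auto)
    then show ?thesis using DERIV_unique DERIV_const by blast
  qed
qed

lemma contact_closed:
  assumes "0 \<le> u" "v < 1" shows "compact (contact \<inter> {u..v})"
proof -
  have "continuous_on {u..v} K"
    by (rule continuous_on_subset[OF DERIV_continuous_on[OF dK]]) (use assms in auto)
  then have "closed ({u..v} \<inter> K -` {k})"
    by (rule continuous_closed_preimage) auto
  moreover have "contact \<inter> {u..v} = {u..v} \<inter> K -` {k}" using assms by (auto simp: contact_def)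
  ultimately have "closed (contact \<inter> {u..v})" by simp
  then show ?thesis by (metis bounded_closed_interval bounded_subset compact_eq_bounded_closed inf_le2)
qed

text \<open>The contact set is closed in \<open>[0,1)\<close>, so there is a nearest contact point on either side of \<open>x\<close>.\<close>

lemma contact_gap:
  assumes "u \<in> contact" "v \<in> contact" "u \<le> x" "x \<le> v" "x \<notin> contact"
  obtains a b where "a \<in> contact" "b \<in> contact" "u \<le> a" "a < x" "x < b" "b \<le> v" "{a<..<b} \<inter> contact = {}"
proof -
  note I = contact_subset[OF assms(1)] contact_subset[OF assms(2)]
  have xI: "0 \<le> x" "x < 1" using I assms by auto
  have ne: "contact \<inter> {u..x} \<noteq> {}" "contact \<inter> {x..v} \<noteq> {}" using assms by auto
  obtain a where a: "a \<in> contact \<inter> {u..x}" "\<And>y. y \<in> contact \<inter> {u..x} \<Longrightarrow> y \<le> a"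
    using compact_attains_sup[OF contact_closed[of u x] ne(1)] I xI by blast
  obtain b where b: "b \<in> contact \<inter> {x..v}" "\<And>y. y \<in> contact \<inter> {x..v} \<Longrightarrow> b \<le> y"
    using compact_attains_inf[OF contact_closed[of x v] ne(2)] I xI by blast
  show thesis
  proof (rule that[of a b])
    show "a < x" "x < b" using a b assms(5) by (auto simp: order_le_less)
    show "{a<..<b} \<inter> contact = {}"
    proof (rule equals0I)
      fix y assume y: "y \<in> {a<..<b} \<inter> contact"
      show False
      proof (cases "y \<le> x")
        case True
        then show False using a(1) a(2)[of y] y by auto
      next
        case False
        then show False using b(1) b(2)[of y] y by auto
      qed
    qed
  qed (use a b in auto)
qed

end

text \<open>
  Where \<open>phi\<close> agrees with the differentiable function \<open>\<eta>\<close>, the slope bounds of lemma \<open>phi_diff_bounds\<close> pinch the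
  distribution function to \<open>- \<eta>'\<close>, so that \<open>\<mu>\<close> has density \<open>- \<eta>''\<close>. One-sided limits of
  the distribution function extend this to the end points, where atoms are excluded by using the open interval.
\<close>

lemma measure_on_contact_interval:
  assumes mu: "\<mu> \<in> Pr01"
    and r: "r1 < r2" "0 \<le> r1" "r2 \<le> 1"
    and d1: "\<And>t. t \<in> {r1..r2} \<Longrightarrow> (\<eta> has_real_derivative \<eta>1 t) (at t)"
    and d2: "\<And>t. t \<in> {r1..r2} \<Longrightarrow> (\<eta>1 has_real_derivative e t) (at t)"
    and ce: "continuous_on {r1..r2} e"
    and neg: "\<And>t. t \<in> {r1..r2} \<Longrightarrow> e t \<le> 0"
    and eq: "\<And>t. r1 < t \<Longrightarrow> t < r2 \<Longrightarrow> phi \<mu> t = \<eta> t"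
    and A: "A \<in> sets borel"
  shows "emeasure (embed \<mu>) (A \<inter> {r1<..<r2}) =
     (\<integral>\<^sup>+s\<in>A. ennreal (- e s) * indicator {r1..r2} s \<partial>lborel)"
proof -
  interpret M: real_distribution "embed \<mu>" by (rule embed_facts[OF mu])
  let ?M = "embed \<mu>"
  have slope: "((\<lambda>t. (\<eta> t - \<eta> s) / (t - s)) \<longlongrightarrow> \<eta>1 s) (at s)" if "s \<in> {r1..r2}" for s
    using d1[OF that] by (simp add: has_field_derivative_iff)
  have cdf: "cdf ?M s = - \<eta>1 s" if s: "r1 < s" "s < r2" for s
  proof (rule antisym)
    have "((\<lambda>t. (\<eta> t - \<eta> s) / (t - s)) \<longlongrightarrow> \<eta>1 s) (at_right s)"
      using slope[of s] s by (auto simp: filterlim_at_split)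
    moreover have "\<forall>\<^sub>F t in at_right s. (\<eta> t - \<eta> s) / (t - s) \<le> - cdf ?M s"
      using eventually_at_right_real[OF s(2)]
    proof (rule eventually_mono)
      fix t assume t: "t \<in> {s<..<r2}"
      then have "cdf ?M s * (t - s) \<le> \<eta> s - \<eta> t"
        using phi_diff_bounds(1)[OF mu, of s t] r s by (simp add: eq)
      then show "(\<eta> t - \<eta> s) / (t - s) \<le> - cdf ?M s" using t by (simp add: divide_simps)
    qed
    ultimately have "\<eta>1 s \<le> - cdf ?M s" by (rule tendsto_upperbound) simp
    then show "cdf ?M s \<le> - \<eta>1 s" by simp
    have "((\<lambda>t. (\<eta> t - \<eta> s) / (t - s)) \<longlongrightarrow> \<eta>1 s) (at_left s)"
      using slope[of s] s by (auto simp: filterlim_at_split)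
    moreover have "\<forall>\<^sub>F t in at_left s. - cdf ?M s \<le> (\<eta> t - \<eta> s) / (t - s)"
      using eventually_at_left_real[OF s(1)]
    proof (rule eventually_mono)
      fix t assume t: "t \<in> {r1<..<s}"
      have "\<eta> t - \<eta> s \<le> measure ?M {..<s} * (s - t)"
        using phi_diff_bounds(2)[OF mu, of t s] r s t by (simp add: eq)
      also have "\<dots> \<le> cdf ?M s * (s - t)"
        unfolding cdf_def using t by (intro mult_right_mono M.finite_measure_mono) auto
      finally show "- cdf ?M s \<le> (\<eta> t - \<eta> s) / (t - s)" using t by (simp add: divide_simps algebra_simps)
    qed
    ultimately have "- cdf ?M s \<le> \<eta>1 s" by (rule tendsto_lowerbound) simp
    then show "- \<eta>1 s \<le> cdf ?M s" by simp
  qed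
  have c1: "(\<eta>1 \<longlongrightarrow> \<eta>1 s) (at s)" if "s \<in> {r1..r2}" for s
    using DERIV_isCont[OF d2[OF that]] by (simp add: isCont_def)
  have cdf_l: "cdf ?M r1 = - \<eta>1 r1"
  proof (rule tendsto_unique)
    show "(cdf ?M \<longlongrightarrow> cdf ?M r1) (at_right r1)" using M.cdf_is_right_cont[of r1] by (simp add: continuous_within)
    have "((\<lambda>t. - \<eta>1 t) \<longlongrightarrow> - \<eta>1 r1) (at_right r1)"
      using c1[of r1] r by (intro tendsto_minus) (auto simp: filterlim_at_split)
    moreover have "\<forall>\<^sub>F t in at_right r1. - \<eta>1 t = cdf ?M t"
      using eventually_at_right_real[OF r(1)] by (rule eventually_mono) (simp add: cdf)
    ultimately show "(cdf ?M \<longlongrightarrow> - \<eta>1 r1) (at_right r1)" by (rule Lim_transform_eventually)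
  qed simp
  have cdf_r: "measure ?M {..<r2} = - \<eta>1 r2"
  proof (rule tendsto_unique)
    show "(cdf ?M \<longlongrightarrow> measure ?M {..<r2}) (at_left r2)" by (rule M.cdf_at_left)
    have "((\<lambda>t. - \<eta>1 t) \<longlongrightarrow> - \<eta>1 r2) (at_left r2)"
      using c1[of r2] r by (intro tendsto_minus) (auto simp: filterlim_at_split)
    moreover have "\<forall>\<^sub>F t in at_left r2. - \<eta>1 t = cdf ?M t"
      using eventually_at_left_real[OF r(1)] by (rule eventually_mono) (simp add: cdf)
    ultimately show "(cdf ?M \<longlongrightarrow> - \<eta>1 r2) (at_left r2)" by (rule Lim_transform_eventually)
  qed simp
  define g where "g = (\<lambda>s. indicator {r1..r2} s *\<^sub>R (- e s))"
  have mg: "g \<in> borel_measurable borel"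
    unfolding g_def by (rule borel_measurable_continuous_on_indicator) (auto intro!: continuous_intros ce)
  have open_meas: "emeasure ?M {y<..<r2} = (\<integral>\<^sup>+s. ennreal (g s) * indicator {y..r2} s \<partial>lborel)"
    if y: "r1 \<le> y" "y < r2" for y
  proof -
    have cy: "cdf ?M y = - \<eta>1 y" using cdf[of y] cdf_l y by (cases "y = r1") auto
    have "{..<r2} = {..y} \<union> {y<..<r2}" using y by auto
    moreover have "measure ?M ({..y} \<union> {y<..<r2}) = cdf ?M y + measure ?M {y<..<r2}"
      unfolding cdf_def by (rule M.finite_measure_Union) auto
    ultimately have "measure ?M {..<r2} = cdf ?M y + measure ?M {y<..<r2}" by simp
    then have m: "measure ?M {y<..<r2} = (- \<eta>1 r2) - (- \<eta>1 y)" using cy cdf_r by simp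
    have "(\<integral>\<^sup>+s. ennreal (g s) * indicator {y..r2} s \<partial>lborel) = ennreal ((- \<eta>1 r2) - (- \<eta>1 y))"
    proof (rule nn_integral_FTC_Icc[OF mg])
      fix x assume x: "x \<in> {y..r2}"
      then show "((\<lambda>x. - \<eta>1 x) has_real_derivative g x) (at x)"
        using d2[of x] y by (auto intro!: derivative_eq_intros simp: g_def)
      show "0 \<le> g x" using x y neg by (auto simp: g_def)
    qed (use y in simp)
    then show ?thesis by (simp add: M.emeasure_eq_measure m)
  qed
  have "density ?M (indicator {r1<..<r2}) = density lborel (\<lambda>s. ennreal (g s))"
  proof (rule measure_eqI_lessThan)
    show "emeasure (density ?M (indicator {r1<..<r2})) {x<..} < \<infinity>" for x :: real
      by (simp add: emeasure_density M.emeasure_eq_measure flip: indicator_inter_arith)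
    show "emeasure (density ?M (indicator {r1<..<r2})) {x<..} = emeasure (density lborel (\<lambda>s. ennreal (g s))) {x<..}" for x :: real
    proof -
      define y where "y = max x r1"
      have "emeasure (density ?M (indicator {r1<..<r2})) {x<..} = emeasure ?M {y<..<r2}"
      proof -
        have "{r1<..<r2} \<inter> {x<..} = {y<..<r2}" by (auto simp: y_def)
        then show ?thesis by (simp add: emeasure_density flip: indicator_inter_arith)
      qed
      moreover have "emeasure (density lborel (\<lambda>s. ennreal (g s))) {x<..} = (\<integral>\<^sup>+s. ennreal (g s) * indicator {y..r2} s \<partial>lborel)"
      proof -
        have "emeasure (density lborel (\<lambda>s. ennreal (g s))) {x<..} = (\<integral>\<^sup>+s. ennreal (g s) * indicator {x<..} s \<partial>lborel)"
          using mg by (simp add: emeasure_density)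
        also have "\<dots> = (\<integral>\<^sup>+s. ennreal (g s) * indicator {y..r2} s \<partial>lborel)"
        proof (rule nn_integral_cong_AE)
          have "AE s in lborel. s \<noteq> x" by (rule AE_lborel_singleton)
          then show "AE s in lborel. ennreal (g s) * indicator {x<..} s = ennreal (g s) * indicator {y..r2} s"
            by (rule eventually_mono) (auto simp: g_def y_def split: split_indicator)
        qed
        finally show ?thesis .
      qed
      moreover have "emeasure ?M {y<..<r2} = (\<integral>\<^sup>+s. ennreal (g s) * indicator {y..r2} s \<partial>lborel)"
      proof (cases "y < r2")
        case True
        then show ?thesis using open_meas[of y] by (simp add: y_def)
      next
        case False
        have "AE s in lborel. s \<noteq> r2" by (rule AE_lborel_singleton)
        then have "AE s in lborel. ennreal (g s) * indicator {y..r2} s = 0"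
          by (rule eventually_mono) (use False in \<open>auto split: split_indicator\<close>)
        then have "(\<integral>\<^sup>+s. ennreal (g s) * indicator {y..r2} s \<partial>lborel) = (\<integral>\<^sup>+s. 0 \<partial>(lborel :: real measure))"
          by (rule nn_integral_cong_AE)
        then show ?thesis using False by simp
      qed
      ultimately show ?thesis by simp
    qed
  qed auto
  then have "emeasure (density ?M (indicator {r1<..<r2})) A = emeasure (density lborel (\<lambda>s. ennreal (g s))) A"
    by simp
  moreover have "emeasure (density ?M (indicator {r1<..<r2})) A = emeasure ?M (A \<inter> {r1<..<r2})"
    using A by (simp add: emeasure_density Int_commute flip: indicator_inter_arith)
  moreover have "emeasure (density lborel (\<lambda>s. ennreal (g s))) A = (\<integral>\<^sup>+s\<in>A. ennreal (- e s) * indicator {r1..r2} s \<partial>lborel)"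
    using A mg by (auto simp: emeasure_density g_def intro!: nn_integral_cong split: split_indicator)
  ultimately show ?thesis by simp
qed

text \<open>
  The situation produced by the first-order condition. The set \<open>T\<close> is the domain of \<open>\<eta>\<close>, and \<open>\<eta>1\<close>, \<open>\<eta>2\<close> are the
  first two derivatives of \<open>\<eta>\<close>.
\<close>

locale contact_problem = contact_set K V W k
  for K V W :: "real \<Rightarrow> real" and k :: real +
  fixes \<mu> :: "real measure" and \<eta> \<eta>1 \<eta>2 :: "real \<Rightarrow> real" and T :: "real set"
  assumes mu: "\<mu> \<in> Pr01"
    and T01: "T \<subseteq> {0..1}"
    and d1: "\<And>t. t \<in> T \<Longrightarrow> (\<eta> has_real_derivative \<eta>1 t) (at t)"
    and d2: "\<And>t. t \<in> T \<Longrightarrow> (\<eta>1 has_real_derivative \<eta>2 t) (at t)"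
    and c2: "continuous_on T \<eta>2"
    and W_nonneg: "\<And>t. t \<in> T \<Longrightarrow> t < 1 \<Longrightarrow> W t \<ge> 0 \<longleftrightarrow> phi \<mu> t \<le> \<eta> t"
    and W_zero: "\<And>t. t \<in> T \<Longrightarrow> t < 1 \<Longrightarrow> W t = 0 \<longleftrightarrow> phi \<mu> t = \<eta> t"
    and supp: "AE x in embed \<mu>. x \<in> contact"
begin

lemma null_off_contact:
  assumes "A \<in> sets borel" "A \<inter> contact = {}" shows "emeasure (embed \<mu>) A = 0"
proof -
  interpret M: real_distribution "embed \<mu>" by (rule embed_facts[OF mu])
  have "AE x in embed \<mu>. \<not> x \<in> A" using supp by eventually_elim (use assms in auto)
  from emeasure_eq_0_AE[OF this] show ?thesis by simp
qed

lemma emeasure_contact_part: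
  assumes "A \<in> sets borel" "B \<in> sets borel" "B \<subseteq> A" "A \<inter> contact \<subseteq> B"
  shows "emeasure (embed \<mu>) A = emeasure (embed \<mu>) B"
proof -
  interpret M: real_distribution "embed \<mu>" by (rule embed_facts[OF mu])
  have "emeasure (embed \<mu>) A = emeasure (embed \<mu>) B + emeasure (embed \<mu>) (A - B)"
    using assms by (subst plus_emeasure) (auto simp: Un_absorb1)
  also have "emeasure (embed \<mu>) (A - B) = 0" using assms by (intro null_off_contact) auto
  finally show ?thesis by simp
qed

text \<open>
  In a gap \<open>phi\<close> is affine, and at its ends \<open>phi \<le> \<eta>\<close>; a concave \<open>\<eta>\<close> then stays above \<open>phi\<close>, the curvature of \<open>K\<close>
  is nonnegative, and the gap consists of contact points.
\<close>

lemma contact_convex_where_concave: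
  assumes uv: "u \<in> contact" "v \<in> contact" "u \<le> v" "{u..v} \<subseteq> T" and neg: "\<And>t. t \<in> {u..v} \<Longrightarrow> \<eta>2 t \<le> 0"
  shows "{u..v} \<subseteq> contact"
proof (rule subsetI, rule ccontr)
  fix x assume x: "x \<in> {u..v}" "x \<notin> contact"
  then obtain a b where ab: "a \<in> contact" "b \<in> contact" "u \<le> a" "a < x" "x < b" "b \<le> v" "{a<..<b} \<inter> contact = {}"
    using contact_gap[OF uv(1,2), of x] by auto
  note I = contact_subset[OF ab(1)] contact_subset[OF ab(2)]
  have abT: "{a..b} \<subseteq> T" using ab uv by auto
  then have "a \<in> T" "b \<in> T" using ab by auto
  have "emeasure (embed \<mu>) {a<..<b} = 0" using ab(7) by (intro null_off_contact) auto
  then have gap: "measure (embed \<mu>) {a<..<b} = 0" by (simp add: measure_def)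
  have aff: "phi \<mu> s = phi \<mu> a - cdf (embed \<mu>) a * (s - a)" if "s \<in> {a..b}" for s
    using that I ab by (intro phi_affine_on_gap[OF mu _ _ gap]) auto
  have end_le: "phi \<mu> a \<le> \<eta> a" "phi \<mu> b \<le> \<eta> b"
    using curvature_nonneg_on_contact[OF ab(1)] curvature_nonneg_on_contact[OF ab(2)]
      W_nonneg[of a] W_nonneg[of b] I ab \<open>a \<in> T\<close> \<open>b \<in> T\<close> by auto
  have con: "concave_on {a..b} (\<lambda>s. \<eta> s - (phi \<mu> a - cdf (embed \<mu>) a * (s - a)))"
  proof (rule f''_le0_imp_concave)
    show "((\<lambda>s. \<eta> s - (phi \<mu> a - cdf (embed \<mu>) a * (s - a))) has_real_derivative (\<eta>1 s + cdf (embed \<mu>) a)) (at s)"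
      if "s \<in> {a..b}" for s
      using d1[of s] that abT by (auto intro!: derivative_eq_intros)
    show "((\<lambda>s. \<eta>1 s + cdf (embed \<mu>) a) has_real_derivative \<eta>2 s) (at s)" if "s \<in> {a..b}" for s
      using d2[of s] that abT by (auto intro!: derivative_eq_intros)
    show "\<eta>2 s \<le> 0" if "s \<in> {a..b}" for s using that ab by (intro neg) auto
  qed simp
  have "phi \<mu> s \<le> \<eta> s" if s: "s \<in> {a..b}" for s
  proof -
    define t where "t = (s - a) / (b - a)"
    have t: "0 \<le> t" "t \<le> 1" using s ab by (auto simp: t_def divide_simps)
    have "t * (b - a) = s - a" using ab by (simp add: t_def)
    then have s_eq: "(1 - t) *\<^sub>R a + t *\<^sub>R b = s" by (simp add: algebra_simps)
    have "0 \<le> (1 - t) * (\<eta> a - phi \<mu> a) + t * (\<eta> b - phi \<mu> b)"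
      using end_le t by simp
    also have "\<dots> = (1 - t) * (\<eta> a - (phi \<mu> a - cdf (embed \<mu>) a * (a - a))) + t * (\<eta> b - (phi \<mu> a - cdf (embed \<mu>) a * (b - a)))"
      using aff[of b] ab by simp
    also have "\<dots> \<le> \<eta> s - (phi \<mu> a - cdf (embed \<mu>) a * (s - a))"
      using concave_onD[OF con t, of a b] ab unfolding s_eq by auto
    finally show ?thesis using aff[OF s] by simp
  qed
  note le = this
  have "W t \<ge> 0" if "a < t" "t < b" for t
    using le[of t] W_nonneg[of t] that abT I by (auto simp: subset_iff)
  then have "{a..b} \<subseteq> contact"
    using ab by (intro contact_between(1)) auto
  moreover have "x \<in> {a..b}" using ab by simp
  ultimately show False using x by blast
qed

text \<open>Strict midpoint convexity of \<open>\<eta>\<close> contradicts concavity of \<open>phi\<close>.\<close>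

lemma no_contact_where_convex:
  assumes xy: "x < y" "{x<..<y} \<subseteq> T" "y < 1" and pos: "\<And>t. t \<in> {x<..<y} \<Longrightarrow> \<eta>2 t > 0"
    and eq: "\<And>t. t \<in> {x<..<y} \<Longrightarrow> phi \<mu> t = \<eta> t"
  shows False
proof -
  define d where "d = (y - x) / 4"
  define s m t where "s = x + d" and "m = x + 2 * d" and "t = x + 3 * d"
  have d: "d > 0" "y = x + 4 * d" using xy by (simp_all add: d_def field_simps)
  have o: "x < s" "s < m" "m < t" "t < y" using d by (auto simp: s_def m_def t_def)
  obtain z1 where z1: "s < z1" "z1 < m" "\<eta> m - \<eta> s = (m - s) * \<eta>1 z1"
    using MVT2[of s m \<eta> \<eta>1] d1 xy o by (auto simp: subset_iff)
  obtain z2 where z2: "m < z2" "z2 < t" "\<eta> t - \<eta> m = (t - m) * \<eta>1 z2"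
    using MVT2[of m t \<eta> \<eta>1] d1 xy o by (auto simp: subset_iff)
  obtain z3 where z3: "z1 < z3" "z3 < z2" "\<eta>1 z2 - \<eta>1 z1 = (z2 - z1) * \<eta>2 z3"
    using MVT2[of z1 z2 \<eta>1 \<eta>2] d2 xy o z1 z2 by (auto simp: subset_iff)
  have "\<eta>2 z3 > 0" using z1 z2 z3 o by (intro pos) auto
  then have "\<eta>1 z2 > \<eta>1 z1" using z3 z1 z2 by (smt (verit) mult_pos_pos)
  then have "d * \<eta>1 z1 < d * \<eta>1 z2" using d by simp
  then have lt: "2 * \<eta> m < \<eta> s + \<eta> t" using z1(3) z2(3) by (simp add: s_def m_def t_def)
  have "1/2 * phi \<mu> s + 1/2 * phi \<mu> t \<le> phi \<mu> ((1/2) *\<^sub>R s + (1/2) *\<^sub>R t)"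
    using concave_onD[OF concave_on_phi[OF mu], of "1/2" s t] o T01 xy(2) by (auto simp: subset_iff)
  also have "(1/2) *\<^sub>R s + (1/2) *\<^sub>R t = m" by (simp add: s_def m_def t_def field_simps)
  finally show False using lt eq[of s] eq[of m] eq[of t] o by auto
qed

text \<open>
  In each of the intervals \<open>(x, y)\<close> and \<open>(y, z)\<close> there is a point with \<open>\<eta> < phi\<close>, for otherwise \<open>\<eta> = phi\<close> on the
  interval. Convexity of \<open>\<eta>\<close> and concavity of \<open>phi\<close> carry the inequality over to \<open>y\<close>, where it contradicts
  nonnegative curvature.
\<close>

lemma no_three_contacts_where_convex:
  assumes S3: "x \<in> contact" "y \<in> contact" "z \<in> contact" and o: "x < y" "y < z"
    and T: "{x<..<z} \<subseteq> T" and pos: "\<And>t. t \<in> {x<..<z} \<Longrightarrow> \<eta>2 t > 0"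
  shows False
proof -
  note I = contact_subset[OF S3(1)] contact_subset[OF S3(2)] contact_subset[OF S3(3)]
  have no: "\<exists>p. u < p \<and> p < v \<and> \<eta> p < phi \<mu> p"
    if uv: "u \<in> contact" "v \<in> contact" "u < v" "{u<..<v} \<subseteq> {x<..<z}" for u v
  proof (rule ccontr)
    assume "\<not> ?thesis"
    then have le: "phi \<mu> p \<le> \<eta> p" if "u < p" "p < v" for p using that by (meson not_le)
    have v1: "v < 1" using contact_subset[OF uv(2)] by simp
    have "W p \<ge> 0" if "u < p" "p < v" for p
      using le[OF that] W_nonneg[of p] that uv(4) T v1 by (auto simp: subset_iff)
    then have "W p = 0" if "u < p" "p < v" for p using contact_between(2)[OF uv(1-3)] that by blast
    then have "phi \<mu> p = \<eta> p" if "p \<in> {u<..<v}" for p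
      using W_zero[of p] that uv(4) T v1 by (auto simp: subset_iff)
    then show False using uv T pos v1 by (intro no_contact_where_convex[of u v]) auto
  qed
  have "{x<..<y} \<subseteq> {x<..<z}" "{y<..<z} \<subseteq> {x<..<z}" using o by auto
  then obtain p q where p: "x < p" "p < y" "\<eta> p < phi \<mu> p" and q: "y < q" "q < z" "\<eta> q < phi \<mu> q"
    using no[OF S3(1,2) o(1)] no[OF S3(2,3) o(2)] by blast
  have "convex_on {x<..<z} \<eta>"
    by (rule f''_ge0_imp_convex[OF _ d1 d2]) (use T pos in \<open>auto intro: less_imp_le\<close>)
  note cv = convex_onD[OF this]
  define t where "t = (y - p) / (q - p)"
  have t: "0 \<le> t" "t \<le> 1" "0 < t" using p q by (auto simp: t_def divide_simps)
  have "t * (q - p) = y - p" using p q by (simp add: t_def)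
  then have y_eq: "(1 - t) *\<^sub>R p + t *\<^sub>R q = y" by (simp add: algebra_simps)
  have "\<eta> y \<le> (1 - t) * \<eta> p + t * \<eta> q"
    using cv[OF t(1,2), of p q] p q o unfolding y_eq by auto
  also have "\<dots> < (1 - t) * phi \<mu> p + t * phi \<mu> q"
    using p q t by (intro add_le_less_mono mult_left_mono mult_strict_left_mono) auto
  also have "\<dots> \<le> phi \<mu> y"
    using concave_onD[OF concave_on_phi[OF mu] t(1,2), of p q] p q o I unfolding y_eq by auto
  finally have "\<not> phi \<mu> y \<le> \<eta> y" by simp
  moreover have "y \<in> T" "y < 1" using T o I by auto
  ultimately show False using W_nonneg[of y] curvature_nonneg_on_contact[OF S3(2)] by simp
qed

text \<open>
  Only the open intervals spanned by points of \<open>C\<close> have to lie in \<open>T\<close>, so that \<open>C\<close> may contain an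
  end point outside the domain of \<open>\<eta>\<close>.
\<close>

lemma two_atoms_where_convex:
  assumes C: "C \<in> sets borel" and H: "C \<subseteq> H" "H \<noteq> {}"
    and inner: "\<And>x z. x \<in> C \<Longrightarrow> z \<in> C \<Longrightarrow> {x<..<z} \<subseteq> T"
    and pos: "\<And>x z t. x \<in> C \<Longrightarrow> z \<in> C \<Longrightarrow> t \<in> {x<..<z} \<Longrightarrow> \<eta>2 t > 0"
  shows "\<exists>q1 q2 m1 m2. q1 \<in> H \<and> q2 \<in> H \<and> m1 \<ge> 0 \<and> m2 \<ge> 0 \<and>
    (\<forall>A\<in>sets borel. emeasure (embed \<mu>) (A \<inter> C) = ennreal m1 * indicator A q1 + ennreal m2 * indicator A q2)"
proof -
  interpret M: real_distribution "embed \<mu>" by (rule embed_facts[OF mu])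
  have three: False if "x \<in> contact \<inter> C" "y \<in> contact \<inter> C" "z \<in> contact \<inter> C" "x < y" "y < z" for x y z
    using no_three_contacts_where_convex[of x y z] inner[of x z] pos[of x z] that by blast
  have "\<exists>q1\<in>H. \<exists>q2\<in>H. contact \<inter> C \<subseteq> {q1, q2}"
  proof (cases "\<exists>x y. x \<in> contact \<inter> C \<and> y \<in> contact \<inter> C \<and> x < y")
    case True
    then obtain x y where xy: "x \<in> contact \<inter> C" "y \<in> contact \<inter> C" "x < y" by blast
    have "contact \<inter> C \<subseteq> {x, y}"
    proof
      fix z assume z: "z \<in> contact \<inter> C"
      show "z \<in> {x, y}"
        using three[of z x y] three[of x z y] three[of x y z] xy z by (cases z x rule: linorder_cases; cases z y rule: linorder_cases) auto
    qed
    then show ?thesis using xy H by blast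
  next
    case False
    then have "x = y" if "x \<in> contact \<inter> C" "y \<in> contact \<inter> C" for x y using that by (metis linorder_neqE_linordered_idom)
    then show ?thesis using H by (cases "contact \<inter> C = {}") blast+
  qed
  then obtain q1 q2 where q: "q1 \<in> H" "q2 \<in> H" "contact \<inter> C \<subseteq> {q1, q2}" by blast
  define m1 where "m1 = measure (embed \<mu>) ({q1} \<inter> C)"
  define m2 where "m2 = (if q2 = q1 then 0 else measure (embed \<mu>) ({q2} \<inter> C))"
  have "emeasure (embed \<mu>) (A \<inter> C) = ennreal m1 * indicator A q1 + ennreal m2 * indicator A q2"
    if A: "A \<in> sets borel" for A
  proof -
    have at: "emeasure (embed \<mu>) (A \<inter> ({q} \<inter> C)) = ennreal (measure (embed \<mu>) ({q} \<inter> C)) * indicator A q" for q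
    proof -
      have "A \<inter> ({q} \<inter> C) = (if q \<in> A then {q} \<inter> C else {})" by auto
      then show ?thesis by (simp add: M.emeasure_eq_measure)
    qed
    have "emeasure (embed \<mu>) (A \<inter> C) = emeasure (embed \<mu>) (A \<inter> ({q1, q2} \<inter> C))"
      using A C q by (intro emeasure_contact_part) auto
    also have "\<dots> = ennreal m1 * indicator A q1 + ennreal m2 * indicator A q2"
    proof (cases "q2 = q1")
      case True
      then show ?thesis using at[of q1] by (simp add: m1_def m2_def)
    next
      case False
      have "A \<inter> ({q1, q2} \<inter> C) = (A \<inter> ({q1} \<inter> C)) \<union> (A \<inter> ({q2} \<inter> C))" by auto
      then have "emeasure (embed \<mu>) (A \<inter> ({q1, q2} \<inter> C)) = emeasure (embed \<mu>) (A \<inter> ({q1} \<inter> C)) + emeasure (embed \<mu>) (A \<inter> ({q2} \<inter> C))"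
        using False A C by (subst plus_emeasure) auto
      then show ?thesis using False at[of q1] at[of q2] by (simp add: m1_def m2_def)
    qed
    finally show ?thesis .
  qed
  moreover have "m1 \<ge> 0" "m2 \<ge> 0" by (simp_all add: m1_def m2_def)
  ultimately show ?thesis using q by blast
qed

text \<open>
  The numbers \<open>r1\<close> and \<open>r2\<close> are the infimum and supremum of the contact points in \<open>[a, b]\<close>. The open interval between
  them consists of contact points and carries the density; the ends may be atoms.
\<close>

lemma density_and_atoms_where_concave:
  assumes ab: "a \<le> b" and T: "{a..b} \<subseteq> T" and neg: "\<And>t. t \<in> {a..b} \<Longrightarrow> \<eta>2 t \<le> 0"
  shows "\<exists>r1 r2 n1 n2. r1 \<in> {a..b} \<and> r2 \<in> {a..b} \<and> r1 \<le> r2 \<and> n1 \<ge> 0 \<and> n2 \<ge> 0 \<and>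
    (\<forall>A\<in>sets borel. emeasure (embed \<mu>) (A \<inter> {a..b}) =
       (\<integral>\<^sup>+s\<in>A. ennreal (- \<eta>2 s) * indicator {r1..r2} s \<partial>lborel)
       + ennreal n1 * indicator A r1 + ennreal n2 * indicator A r2)"
proof -
  interpret M: real_distribution "embed \<mu>" by (rule embed_facts[OF mu])
  have null: "(\<integral>\<^sup>+s\<in>A. ennreal (- \<eta>2 s) * indicator {r..r} s \<partial>lborel) = 0" for A r
  proof -
    have "AE s in lborel. s \<noteq> r" by (rule AE_lborel_singleton)
    then have "AE s in lborel. ennreal (- \<eta>2 s) * indicator {r..r} s * indicator A s = 0"
      by (rule eventually_mono) (auto split: split_indicator)
    then have "(\<integral>\<^sup>+s\<in>A. ennreal (- \<eta>2 s) * indicator {r..r} s \<partial>lborel) = (\<integral>\<^sup>+s. 0 \<partial>(lborel :: real measure))"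
      by (rule nn_integral_cong_AE)
    then show ?thesis by simp
  qed
  have at: "emeasure (embed \<mu>) (A \<inter> {r}) = ennreal (measure (embed \<mu>) {r}) * indicator A r" for A r
    by (cases "r \<in> A") (auto simp: M.emeasure_eq_measure)
  show ?thesis
  proof (cases "contact \<inter> {a..b} = {}")
    case True
    have "emeasure (embed \<mu>) (A \<inter> {a..b}) = 0" if "A \<in> sets borel" for A
      using that True by (intro null_off_contact) auto
    then show ?thesis
      using ab null[of a] by (intro exI[of _ a] exI[of _ "0::real"] conjI) auto
  next
    case False
    define P where "P = contact \<inter> {a..b}"
    define r1 r2 where "r1 = Inf P" and "r2 = Sup P"
    have P: "P \<noteq> {}" "bdd_below P" "bdd_above P" using False by (auto simp: P_def)
    have bnd: "r1 \<le> x" "x \<le> r2" if "x \<in> P" for x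
      using that P by (auto simp: r1_def r2_def intro: cInf_lower cSup_upper)
    have r: "r1 \<in> {a..b}" "r2 \<in> {a..b}" "r1 \<le> r2"
    proof -
      obtain x where x: "x \<in> P" using P by blast
      have "a \<le> r1" unfolding r1_def using P by (intro cInf_greatest) (auto simp: P_def)
      moreover have "r2 \<le> b" unfolding r2_def using P by (intro cSup_least) (auto simp: P_def)
      ultimately show "r1 \<in> {a..b}" "r2 \<in> {a..b}" "r1 \<le> r2" using bnd[OF x] by auto
    qed
    have red: "emeasure (embed \<mu>) (A \<inter> {a..b}) = emeasure (embed \<mu>) (A \<inter> {r1..r2})" if "A \<in> sets borel" for A
      using that r bnd by (intro emeasure_contact_part) (auto simp: P_def)
    show ?thesis
    proof (cases "r1 = r2")
      case True
      then have "emeasure (embed \<mu>) (A \<inter> {a..b}) = ennreal (measure (embed \<mu>) {r1}) * indicator A r1" if "A \<in> sets borel" for A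
        using red[OF that] at[of A r1] by simp
      then show ?thesis
        using r null[of r1] True by (intro exI[of _ r1] exI[of _ "measure (embed \<mu>) {r1}"] exI[of _ "0::real"] conjI) auto
    next
      case False
      then have lt: "r1 < r2" using r by simp
      have eq: "phi \<mu> t = \<eta> t" if t: "r1 < t" "t < r2" for t
      proof -
        obtain u where u: "u \<in> P" "u < t" using cInf_less_iff[OF P(1,2), of t] t by (auto simp: r1_def)
        obtain v where v: "v \<in> P" "t < v" using less_cSup_iff[OF P(1,3), of t] t by (auto simp: r2_def)
        have uv: "{u..v} \<subseteq> {a..b}" using u v by (auto simp: P_def)
        have uvS: "{u..v} \<subseteq> contact"
          using u v uv T neg by (intro contact_convex_where_concave) (auto simp: P_def)
        have "u \<in> contact" "v \<in> contact" "u < v" using u v by (auto simp: P_def)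
        moreover have "W x \<ge> 0" if "u < x" "x < v" for x
          using uvS that by (intro curvature_nonneg_on_contact) auto
        ultimately have "W t = 0" using u v by (intro contact_between(2)[of u v]) auto
        moreover have "t \<in> {u..v}" using u v by simp
        then have "t \<in> T" "t < 1" using uv T uvS contact_subset[of t] by blast+
        ultimately show ?thesis using W_zero by blast
      qed
      have rT: "{r1..r2} \<subseteq> T" using r T by auto
      have "emeasure (embed \<mu>) (A \<inter> {a..b}) =
         (\<integral>\<^sup>+s\<in>A. ennreal (- \<eta>2 s) * indicator {r1..r2} s \<partial>lborel)
         + ennreal (measure (embed \<mu>) {r1}) * indicator A r1 + ennreal (measure (embed \<mu>) {r2}) * indicator A r2"
        if A: "A \<in> sets borel" for A
      proof -
        have "A \<inter> {r1..r2} = (A \<inter> {r1<..<r2} \<union> A \<inter> {r1}) \<union> A \<inter> {r2}" using lt by auto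
        then have "emeasure (embed \<mu>) (A \<inter> {r1..r2}) = emeasure (embed \<mu>) (A \<inter> {r1<..<r2} \<union> A \<inter> {r1}) + emeasure (embed \<mu>) (A \<inter> {r2})"
          using A lt by (simp only:) (subst plus_emeasure, auto)
        also have "emeasure (embed \<mu>) (A \<inter> {r1<..<r2} \<union> A \<inter> {r1}) = emeasure (embed \<mu>) (A \<inter> {r1<..<r2}) + emeasure (embed \<mu>) (A \<inter> {r1})"
          using A by (subst plus_emeasure) auto
        also have "emeasure (embed \<mu>) (A \<inter> {r1<..<r2}) = (\<integral>\<^sup>+s\<in>A. ennreal (- \<eta>2 s) * indicator {r1..r2} s \<partial>lborel)"
        proof (rule measure_on_contact_interval[OF mu lt _ _ d1 d2 _ _ eq A])
          have "r1 \<in> T" "r2 \<in> T" using rT lt by auto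
          then show "0 \<le> r1" "r2 \<le> 1" using T01 by auto
          show "continuous_on {r1..r2} \<eta>2" by (rule continuous_on_subset[OF c2 rT])
          show "\<eta>2 t \<le> 0" if "t \<in> {r1..r2}" for t using that r by (intro neg) auto
        qed (use rT in auto)
        finally show ?thesis unfolding red[OF A] at .
      qed
      then show ?thesis using r
        by (intro exI[of _ r1] exI[of _ r2] exI[of _ "measure (embed \<mu>) {r1}"] exI[of _ "measure (embed \<mu>) {r2}"] conjI) auto
    qed
  qed
qed

end

section \<open>The form of the minimizer\<close>

theorem corollary1p5:
  fixes \<beta> h \<epsilon> :: real and b :: "nat \<Rightarrow> real" and \<xi> :: "real \<Rightarrow> real" and \<mu> :: "real measure"
  assumes xi: "\<xi> = mixture \<beta> b"
    and nonzero: "\<exists>t\<in>{0..1}. \<xi> t \<noteq> 0"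
    and eps: "\<epsilon> > 0"
    and conv: "summable (\<lambda>p. (b (p + 2))\<^sup>2 * (1 + \<epsilon>) ^ (p + 2))"
    and h: "h \<ge> 0"
    and minimizer: "is_arg_min (crisanti_sommers \<xi> h) (\<lambda>\<nu>. \<nu> \<in> Pr01) \<mu>"
  shows "finite (components (dd_pos \<xi>)) \<and> finite (components (dd_nonpos \<xi>)) \<and>
    (\<exists>q1 q2 m1 m2 r1 r2 n1 n2 :: real set \<Rightarrow> real.
      (\<forall>C\<in>components (dd_pos \<xi>).
         q1 C \<in> hull_interval C \<and> q2 C \<in> hull_interval C \<and> m1 C \<ge> 0 \<and> m2 C \<ge> 0) \<and>
      (\<forall>C\<in>components (dd_nonpos \<xi>).
         r1 C \<in> hull_interval C \<and> r2 C \<in> hull_interval C \<and> r1 C \<le> r2 C \<and>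
         n1 C \<ge> 0 \<and> n2 C \<ge> 0) \<and>
      (\<forall>A\<in>sets \<mu>.
         emeasure \<mu> A =
           (\<Sum>C\<in>components (dd_pos \<xi>).
              ennreal (m1 C) * indicator A (q1 C) + ennreal (m2 C) * indicator A (q2 C)) +
           (\<Sum>C\<in>components (dd_nonpos \<xi>).
              (\<integral>\<^sup>+s\<in>A. ennreal (- dd \<xi> s) * indicator {r1 C..r2 C} s \<partial>lborel)
              + ennreal (n1 C) * indicator A (r1 C) + ennreal (n2 C) * indicator A (r2 C))))"
proof -
  define \<eta> where "\<eta> = (\<lambda>t. 1 / sqrt (deriv2 \<xi> t))"
  note D = dd_structure[OF xi nonzero eps conv, folded \<eta>_def]
  have mu: "\<mu> \<in> Pr01" using minimizer by (simp add: is_arg_min_def)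
  have min: "crisanti_sommers \<xi> h \<mu> \<le> crisanti_sommers \<xi> h \<nu>" if "\<nu> \<in> Pr01" for \<nu>
    using minimizer that by (auto simp: is_arg_min_def not_less)
  define W where "W = (\<lambda>s. 1 / (phi \<mu> s)\<^sup>2 - deriv2 \<xi> s)"
  define K where "K = (\<lambda>x. (LINT s:I01|lborel. W s * max 0 (x - s)) - h\<^sup>2 * x)"
  define V where "V = (\<lambda>x. integral {0..x} W - h\<^sup>2)"
  have "\<exists>k. (\<forall>x\<in>I01. k \<le> K x) \<and> (AE x in embed \<mu>. x \<in> I01 \<and> K x = k)"
    unfolding K_def W_def by (rule euler_lagrange[OF mu min D(1)])
  then obtain k where k0: "(\<forall>x\<in>I01. k \<le> K x) \<and> (AE x in embed \<mu>. x \<in> I01 \<and> K x = k)"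
    by (rule exE)
  have k: "\<And>x. x \<in> I01 \<Longrightarrow> k \<le> K x" "AE x in embed \<mu>. x \<in> I01 \<and> K x = k"
    using k0 by simp_all
  have phi_pos: "phi \<mu> t > 0" if "t \<in> I01" for t
  proof -
    have "0 < phi \<mu> 0 * (1 - t)"
      using phi_0_pos[OF mu minimizer_energy_finite[OF mu min]] that by simp
    also have "\<dots> \<le> phi \<mu> t" using that by (intro phi_lower[OF mu]) auto
    finally show ?thesis .
  qed
  have cW: "continuous_on I01 W"
    unfolding W_def
    by (intro continuous_intros continuous_on_subset[OF continuous_on_phi[OF mu]] continuous_on_subset[OF D(1)])
       (use phi_pos in force)+
  have dom01: "dd_dom \<xi> \<subseteq> {0..1}" by (auto simp: dd_dom_def)
  have W_sign: "W t \<ge> 0 \<longleftrightarrow> phi \<mu> t \<le> \<eta> t" "W t = 0 \<longleftrightarrow> phi \<mu> t = \<eta> t" if t: "t \<in> dd_dom \<xi>" "t < 1" for t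
  proof -
    have p: "phi \<mu> t > 0" using t dom01 by (intro phi_pos) auto
    define y where "y = sqrt (deriv2 \<xi> t)"
    have y: "y > 0" "deriv2 \<xi> t = y\<^sup>2" using t by (auto simp: y_def dd_dom_def)
    have w: "W t = (1 / phi \<mu> t)\<^sup>2 - y\<^sup>2" by (simp add: W_def y(2) power_divide)
    have "W t \<ge> 0 \<longleftrightarrow> y \<le> 1 / phi \<mu> t"
      unfolding w using p y(1) by (simp add: power2_le_iff_abs_le)
    also have "\<dots> \<longleftrightarrow> phi \<mu> t \<le> \<eta> t" using p y(1) by (simp add: \<eta>_def y_def[symmetric] field_simps)
    finally show "W t \<ge> 0 \<longleftrightarrow> phi \<mu> t \<le> \<eta> t" .
    have "W t = 0 \<longleftrightarrow> 1 / phi \<mu> t = y"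
      unfolding w using p y(1) by (simp add: power2_eq_iff_nonneg del: power_divide)
    also have "\<dots> \<longleftrightarrow> phi \<mu> t = \<eta> t" using p y(1) by (auto simp: \<eta>_def y_def[symmetric] field_simps)
    finally show "W t = 0 \<longleftrightarrow> phi \<mu> t = \<eta> t" .
  qed
  note DP = double_primitive[OF cW, where a = "h\<^sup>2", folded K_def V_def]
  interpret CS: contact_set K V W k
    by unfold_locales (use DP k(1) cW in \<open>auto simp: V_def\<close>)
  interpret contact_problem K V W k \<mu> \<eta> "deriv \<eta>" "dd \<xi>" "dd_dom \<xi>"
  proof unfold_locales
    show "AE x in embed \<mu>. x \<in> CS.contact"
      by (rule eventually_mono[OF k(2)]) (simp add: CS.contact_def)
  qed (use mu dom01 D(4,5,6) W_sign in auto)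
  let ?P = "components (dd_pos \<xi>)" and ?N = "components (dd_nonpos \<xi>)"
  have dom: "dd_dom \<xi> = dd_pos \<xi> \<union> dd_nonpos \<xi>" "dd_pos \<xi> \<inter> dd_nonpos \<xi> = {}"
    by (auto simp: dd_pos_def dd_nonpos_def)
  have posI: "x \<in> dd_dom \<xi>" "0 < dd \<xi> x" if "x \<in> dd_pos \<xi>" for x using that by (auto simp: dd_pos_def)
  have dom_off0: "t \<in> dd_dom \<xi>" if "0 < t" "t \<le> 1" for t using D(2) that by (simp add: dd_dom_def)
  have comp: "C \<noteq> {}" "connected C" "C \<subseteq> X" "bdd_below C" "bdd_above C" "C \<in> sets borel" "C \<subseteq> hull_interval C"
    if "C \<in> components X" "X \<subseteq> {0..1::real}" for C X
  proof -
    show *: "C \<noteq> {}" "connected C" "C \<subseteq> X"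
      using in_components_nonempty[OF that(1)] in_components_connected[OF that(1)] in_components_subset[OF that(1)] by auto
    show **: "bdd_below C" "bdd_above C" using * that(2) by (meson bdd_below_Icc bdd_above_Icc bdd_below_mono bdd_above_mono subset_trans)+
    show "C \<in> sets borel" by (rule connected_real_borel) fact
    show "C \<subseteq> hull_interval C" using ** by (auto simp: hull_interval_def intro: cInf_lower cSup_upper)
  qed
  have pn01: "dd_pos \<xi> \<subseteq> {0..1}" "dd_nonpos \<xi> \<subseteq> {0..1}" using dom dom01 by auto

  \<comment> \<open>If \<open>0\<close> is outside the domain of \<open>dd\<close>, its mass is assigned to the component \<open>C0\<close> of \<open>{dd > 0}\<close> adjacent to it.\<close>
  define Z where "Z = {0::real} - dd_dom \<xi>"
  have Z_borel: "Z \<in> sets borel"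
    by (intro borel_closed finite_imp_closed) (simp add: Z_def)
  obtain C0 \<delta> where C0: "Z \<noteq> {} \<Longrightarrow> 0 < \<delta> \<and> C0 \<in> ?P \<and> {0<..<\<delta>} \<subseteq> C0"
  proof (cases "Z = {}")
    case False
    then have "deriv2 \<xi> 0 = 0" using D(3) by (auto simp: Z_def dd_dom_def)
    then obtain \<delta> where d: "0 < \<delta>" "{0<..<\<delta>} \<subseteq> dd_pos \<xi>" using D(10) by blast
    then have "{0<..<\<delta>} \<noteq> {}" by auto
    then obtain C where "C \<in> ?P" "{0<..<\<delta>} \<subseteq> C"
      using exists_component_superset[OF d(2) _ connected_Ioo] d by (metis empty_subsetI subset_empty)
    then show thesis using that d by blast
  qed (use that in blast)
  define E where "E = (\<lambda>C. C \<union> (if C = C0 then Z else {}))"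
  have E_sub: "E C \<subseteq> {0..1}" "E C - {0} \<subseteq> C" if "C \<in> ?P" for C
    using comp(3)[OF that pn01(1)] pn01 by (auto simp: E_def Z_def)
  have E_inner: "{x<..<z} \<subseteq> C" if C: "C \<in> ?P" and xz: "x \<in> E C" "z \<in> E C" for C x z
  proof
    fix t assume t: "t \<in> {x<..<z}"
    have "0 \<le> x" using E_sub(1)[OF C] xz by auto
    then have zC: "z \<in> C" "0 < t" using t xz E_sub(2)[OF C] by auto
    show "t \<in> C"
    proof (cases "x \<in> C")
      case True
      then show ?thesis using connectedD_interval[OF comp(2)[OF C pn01(1)] True zC(1), of t] t by auto
    next
      case False
      then have "Z \<noteq> {}" "C = C0" using xz by (auto simp: E_def split: if_splits)
      then have d: "0 < \<delta>" "{0<..<\<delta>} \<subseteq> C" using C0 by auto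
      have "min t \<delta> / 2 \<in> C" using d zC by (intro subsetD[OF d(2)]) auto
      then show ?thesis
        using connectedD_interval[OF comp(2)[OF C pn01(1)] _ zC(1), of "min t \<delta> / 2" t] t zC by auto
    qed
  qed
  have E_hull: "E C \<subseteq> hull_interval C" if C: "C \<in> ?P" for C
  proof -
    have "0 \<in> hull_interval C" if z: "Z \<noteq> {}" "C = C0"
    proof -
      have d: "0 < \<delta>" "{0<..<\<delta>} \<subseteq> C" using C0 z by auto
      have "Inf C \<le> 0"
      proof (rule ccontr)
        assume "\<not> Inf C \<le> 0"
        then have "min (Inf C) \<delta> / 2 \<in> C" using d by (intro subsetD[OF d(2)]) auto
        then have "Inf C \<le> min (Inf C) \<delta> / 2" by (rule cInf_lower[OF _ comp(4)[OF C pn01(1)]])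
        then show False using \<open>\<not> Inf C \<le> 0\<close> by (simp add: min_def split: if_splits)
      qed
      moreover have "\<delta> / 2 \<in> C" using d by (intro subsetD[OF d(2)]) auto
      then have "\<delta> / 2 \<le> Sup C" by (rule cSup_upper[OF _ comp(5)[OF C pn01(1)]])
      ultimately show ?thesis using d by (simp add: hull_interval_def)
    qed
    then show ?thesis using comp(7)[OF C pn01(1)] by (auto simp: E_def Z_def)
  qed
  define QP where "QP = (\<lambda>C q1 q2 m1 m2. q1 \<in> hull_interval C \<and> q2 \<in> hull_interval C \<and> m1 \<ge> 0 \<and> m2 \<ge> 0 \<and>
    (\<forall>A\<in>sets borel. emeasure (embed \<mu>) (A \<inter> E C) = ennreal m1 * indicator A q1 + ennreal m2 * indicator A q2))"
  have "\<exists>q1 q2 m1 m2. QP C q1 q2 m1 m2"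
    if C: "C \<in> ?P" for C
    unfolding QP_def
  proof (rule two_atoms_where_convex)
    have inP: "{x<..<z} \<subseteq> dd_pos \<xi>" if "x \<in> E C" "z \<in> E C" for x z
      using E_inner[OF C that] comp(3)[OF C pn01(1)] by blast
    then show "{x<..<z} \<subseteq> dd_dom \<xi>" if "x \<in> E C" "z \<in> E C" for x z using that dom by blast
    show "0 < dd \<xi> t" if "x \<in> E C" "z \<in> E C" "t \<in> {x<..<z}" for x z t using inP that posI by blast
    show "E C \<in> sets borel" using comp(6)[OF C pn01(1)] Z_borel by (auto simp: E_def)
    show "E C \<subseteq> hull_interval C" "hull_interval C \<noteq> {}" using E_hull[OF C] comp(1,7)[OF C pn01(1)] by auto
  qed
  then obtain q1 q2 m1 m2 where P: "\<And>C. C \<in> ?P \<Longrightarrow> QP C (q1 C) (q2 C) (m1 C) (m2 C)"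
    by metis
  define QN where "QN = (\<lambda>C r1 r2 n1 n2. r1 \<in> hull_interval C \<and> r2 \<in> hull_interval C \<and> r1 \<le> r2 \<and> n1 \<ge> 0 \<and> n2 \<ge> 0 \<and>
    (\<forall>A\<in>sets borel. emeasure (embed \<mu>) (A \<inter> C) =
       (\<integral>\<^sup>+s\<in>A. ennreal (- dd \<xi> s) * indicator {r1..r2} s \<partial>lborel)
       + ennreal n1 * indicator A r1 + ennreal n2 * indicator A r2))"
  have "\<exists>r1 r2 n1 n2. QN C r1 r2 n1 n2"
    if C: "C \<in> ?N" for C
  proof -
    note c = comp[OF C pn01(2)]
    have "closed C" by (rule closed_components[OF D(9) C])
    then have IS: "Inf C \<in> C" "Sup C \<in> C" using c by (auto intro: closed_contains_Inf closed_contains_Sup)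
    have eq: "C = {Inf C..Sup C}"
      using c(7) connected_contains_Icc[OF c(2) IS] by (auto simp: hull_interval_def)
    have np: "{Inf C..Sup C} \<subseteq> dd_nonpos \<xi>" using c(3) eq by simp
    have "\<exists>r1 r2 n1 n2. r1 \<in> {Inf C..Sup C} \<and> r2 \<in> {Inf C..Sup C} \<and> r1 \<le> r2 \<and> n1 \<ge> 0 \<and> n2 \<ge> 0 \<and>
    (\<forall>A\<in>sets borel. emeasure (embed \<mu>) (A \<inter> {Inf C..Sup C}) =
       (\<integral>\<^sup>+s\<in>A. ennreal (- dd \<xi> s) * indicator {r1..r2} s \<partial>lborel)
       + ennreal n1 * indicator A r1 + ennreal n2 * indicator A r2)"
    proof (rule density_and_atoms_where_concave)
      show "Inf C \<le> Sup C" using IS eq by auto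
      show "{Inf C..Sup C} \<subseteq> dd_dom \<xi>" using np dom by blast
      show "dd \<xi> t \<le> 0" if "t \<in> {Inf C..Sup C}" for t using np that by (auto simp: dd_nonpos_def)
    qed
    then show ?thesis unfolding QN_def eq[symmetric] hull_interval_def .
  qed
  then obtain r1 r2 n1 n2 where N: "\<And>C. C \<in> ?N \<Longrightarrow> QN C (r1 C) (r2 C) (n1 C) (n2 C)"
    by metis
  have total: "emeasure \<mu> A = (\<Sum>C\<in>?P. emeasure (embed \<mu>) (A \<inter> E C)) + (\<Sum>C\<in>?N. emeasure (embed \<mu>) (A \<inter> C))"
    if A: "A \<in> sets \<mu>" for A
  proof -
    interpret M: real_distribution "embed \<mu>" by (rule embed_facts[OF mu])
    have AB: "A \<in> sets borel" "A \<subseteq> {0..1}" using Pr01D(4)[OF mu] A by auto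
    have dZ: "Z \<inter> dd_dom \<xi> = {}" by (auto simp: Z_def)
    have EC: "A \<inter> E C \<in> sets borel" if "C \<in> ?P" for C
      using comp(6)[OF that pn01(1)] AB Z_borel by (auto simp: E_def)
    have unP: "(\<Union>C\<in>?P. E C) = dd_pos \<xi> \<union> Z"
    proof -
      have "(\<Union>C\<in>?P. E C) = \<Union>?P \<union> (\<Union>C\<in>?P. if C = C0 then Z else {})"
        by (simp add: E_def UN_Un_distrib)
      also have "(\<Union>C\<in>?P. if C = C0 then Z else {}) = Z"
        using C0 by (cases "Z = {}") auto
      also have "\<Union>?P = dd_pos \<xi>" by (rule Union_components)
      finally show ?thesis .
    qed
    have unN: "\<Union>?N = dd_nonpos \<xi>" by (rule Union_components)
    have disP: "disjoint_family_on (\<lambda>C. A \<inter> E C) ?P"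
      unfolding disjoint_family_on_def
    proof (intro ballI impI)
      fix C C' assume C: "C \<in> ?P" "C' \<in> ?P" "C \<noteq> C'"
      have CC: "C \<inter> C' = {}" using components_eq[OF C(1,2)] C(3) by simp
      have CZ: "C \<inter> Z = {}" "Z \<inter> C' = {}"
        using comp(3)[OF C(1) pn01(1)] comp(3)[OF C(2) pn01(1)] dZ dom(1) by auto
      have "E C \<inter> E C' = {}"
        unfolding E_def using C(3) C(3)[symmetric] CC CZ
        by (cases "C = C0") (simp_all add: Int_Un_distrib Int_Un_distrib2)
      then show "(A \<inter> E C) \<inter> (A \<inter> E C') = {}" by blast
    qed
    have disN: "disjoint_family_on (\<lambda>C. A \<inter> C) ?N"
      unfolding disjoint_family_on_def
    proof (intro ballI impI)
      fix C C' assume C: "C \<in> ?N" "C' \<in> ?N" "C \<noteq> C'"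
      have "C \<inter> C' = {}" using components_eq[OF C(1,2)] C(3) by simp
      then show "(A \<inter> C) \<inter> (A \<inter> C') = {}" by blast
    qed
    have sP: "(\<Sum>C\<in>?P. emeasure (embed \<mu>) (A \<inter> E C)) = emeasure (embed \<mu>) (\<Union>C\<in>?P. A \<inter> E C)"
      by (rule sum_emeasure) (use EC disP D(7) in auto)
    have sN: "(\<Sum>C\<in>?N. emeasure (embed \<mu>) (A \<inter> C)) = emeasure (embed \<mu>) (\<Union>C\<in>?N. A \<inter> C)"
      by (rule sum_emeasure) (use comp(6)[OF _ pn01(2)] AB disN D(8) in auto)
    have eP: "(\<Union>C\<in>?P. A \<inter> E C) = A \<inter> (dd_pos \<xi> \<union> Z)"
      by (simp only: Int_UN_distrib[symmetric] unP)
    have eN: "(\<Union>C\<in>?N. A \<inter> C) = A \<inter> dd_nonpos \<xi>"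
      by (simp only: Int_Union[symmetric] unN)
    have "x \<in> dd_pos \<xi> \<union> Z \<union> dd_nonpos \<xi>" if "x \<in> {0..1}" for x
      using dom_off0[of x] that dom(1) by (cases "x = 0") (auto simp: Z_def)
    then have "(\<Union>C\<in>?P. A \<inter> E C) \<union> (\<Union>C\<in>?N. A \<inter> C) = A"
      unfolding eP eN using AB(2) by blast
    moreover have "(\<Union>C\<in>?P. A \<inter> E C) \<inter> (\<Union>C\<in>?N. A \<inter> C) = {}"
      unfolding eP eN using dom dZ by blast
    moreover have "(\<Union>C\<in>?P. A \<inter> E C) \<in> sets (embed \<mu>)"
      by (rule sets.finite_UN[OF D(7)]) (use EC in simp)
    moreover have "(\<Union>C\<in>?N. A \<inter> C) \<in> sets (embed \<mu>)"
      by (rule sets.finite_UN[OF D(8)]) (use comp(6)[OF _ pn01(2)] AB in auto)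
    ultimately have "emeasure (embed \<mu>) A = emeasure (embed \<mu>) (\<Union>C\<in>?P. A \<inter> E C) + emeasure (embed \<mu>) (\<Union>C\<in>?N. A \<inter> C)"
      by (metis plus_emeasure)
    then show ?thesis unfolding sP sN embed_facts(3)[OF mu A] .
  qed
  show ?thesis
  proof (intro conjI exI ballI)
    fix A assume A: "A \<in> sets \<mu>"
    then have AB: "A \<in> sets borel" using Pr01D(4)[OF mu] by auto
    show "emeasure \<mu> A =
           (\<Sum>C\<in>?P. ennreal (m1 C) * indicator A (q1 C) + ennreal (m2 C) * indicator A (q2 C)) +
           (\<Sum>C\<in>?N. (\<integral>\<^sup>+s\<in>A. ennreal (- dd \<xi> s) * indicator {r1 C..r2 C} s \<partial>lborel)
              + ennreal (n1 C) * indicator A (r1 C) + ennreal (n2 C) * indicator A (r2 C))"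
      unfolding total[OF A] using P[unfolded QP_def] N[unfolded QN_def] AB by (intro arg_cong2[where f = "(+)"] sum.cong) auto
  qed (use P[unfolded QP_def] N[unfolded QN_def] D(7,8) in auto)
qed

end
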